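(* Let $(\Omega,\mathscr F,\mathbb P)$ be a probability space, let $(\mathcal Y,\lVert\cdot\rVert_{\mathcal Y})$ be a separable $\mathbb R$-Banach space, let $\mathfrak z,\gamma\in[0,\infty)$, $\mathfrak B,\mathfrak b,C\in[1,\infty)$, $c\in(0,\infty)$, $(\mathfrak c_k)_{k\in\mathbb N_0}\subseteq(0,\infty)$, $\Theta=\bigcup_{n=1}^\infty\mathbb Z^n$, $(M_j)_{j\in\mathbb N}\subseteq\mathbb N$, $y,\mathfrak y_{-1},\mathfrak y_0\in\mathcal Y$ satisfy $\liminf_{j\to\infty}M_j=\infty$, $\sup_{j\in\mathbb N}M_{j+1}/M_j\le\mathfrak B$, and, for all $n\in\mathbb N$, $\max_{k\in\{0,1,\ldots,n\}}(M_n)^k/\mathfrak c_k\le\mathfrak b^n$. Let $(\mathcal Z,\mathscr Z)$ be a measurable space, let $Z^\theta\colon\Omega\to\mathcal Z$, $\theta\in\Theta$, be i.i.d. $\mathscr F/\mathscr Z$-measurable functions, let $(\mathcal H,\langle\cdot,\cdot\rangle_{\mathcal H},\lVert\cdot\rVert_{\mathcal H})$ be a separable $\mathbb R$-Hilbert space, let $\mathscr S$ be the $\sigma$-algebra on $L(\mathcal Y,\mathcal H)$ generated by the sets $\{\varphi\in L(\mathcal Y,\mathcal H)\colon\varphi(x)\in\mathcal B\}$, $x\in\mathcal Y$, $\mathcal B\in\mathscr B(\mathcal H)$, let $\psi_k\colon\Omega\to L(\mathcal Y,\mathcal H)$, $k\in\mathbb N_0$, be $\mathscr F/\mathscr S$-measurable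 functions, and assume that $(Z^\theta)_{\theta\in\Theta}$ and $(\psi_k)_{k\in\mathbb N_0}$ are independent. Let $\Phi_l\colon\mathcal Y\times\mathcal Y\times\mathcal Z\to\mathcal Y$, $l\in\mathbb N_0$, be $(\mathscr B(\mathcal Y)\otimes\mathscr B(\mathcal Y)\otimes\mathscr Z)/\mathscr B(\mathcal Y)$-measurable functions. Let $Y^\theta_{n,j}\colon\Omega\to\mathcal Y$, $\theta\in\Theta$, $j\in\mathbb N$, $n\in\mathbb N_0\cup\{-1\}$, satisfy for all $n,j\in\mathbb N$, $\theta\in\Theta$ that $Y^\theta_{-1,j}=\mathfrak y_{-1}$, $Y^\theta_{0,j}=\mathfrak y_0$, and $$Y^\theta_{n,j}=\sum_{l=0}^{n-1}\frac1{(M_j)^{n-l}}\Biggl[\sum_{i=1}^{(M_j)^{n-l}}\Phi_l\bigl(Y^{(\theta,l,i)}_{l,j},Y^{(\theta,-l,i)}_{l-1,j},Z^{(\theta,l,i)}\bigr)\Biggr].$$ Let $(\mathrm{Cost}_{n,j})_{(n,j)\in(\mathbb N_0\cup\{-1\})\times\mathbb N}\subseteq[0,\infty)$ satisfy for all $n,j\in\mathbb N$ that $\mathrm{Cost}_{-1,j}=\mathrm{Cost}_{0,j}=0$ and $$\mathrm{Cost}_{n,j}\le(M_j)^n\mathfrak z+\sum_{l=0}^{n-1}\bigl[(M_j)^{n-l}(\mathrm{Cost}_{l,j}+\mathrm{Cost}_{l-1,j}+\gamma\mathfrak z)\bigr].$$ Assume for all $k\in\mathbb N_0$, $n,j\in\mathbb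 N$ that $\mathbb E[\lVert\Phi_k(Y^0_{k,j},Y^1_{k-1,j},Z^0)\rVert_{\mathcal Y}]<\infty$ and $$\max\bigl\{\mathbb E[\lVert\psi_k(\Phi_0(\mathfrak y_0,\mathfrak y_{-1},Z^0))\rVert_{\mathcal H}^2],\ \mathbb 1_{\mathbb N}(k)\,\mathbb E[\lVert\psi_k(\mathfrak y_0-y)\rVert_{\mathcal H}^2]\bigr\}\le\frac{C^2}{\mathfrak c_k},$$ $$\mathbb E\bigl[\lVert\psi_k(\Phi_n(Y^0_{n,j},Y^1_{n-1,j},Z^0))\rVert_{\mathcal H}^2\bigr]\le c\,\mathbb E\bigl[\lVert\psi_{k+1}(Y^0_{n,j}-Y^1_{n-1,j})\rVert_{\mathcal H}^2\bigr],$$ $$\mathbb E\Bigl[\Bigl\lVert\psi_k\Bigl(y-\sum_{l=0}^{n-1}\mathbb E\bigl[\Phi_l(Y^0_{l,j},Y^1_{l-1,j},Z^0)\bigr]\Bigr)\Bigr\rVert_{\mathcal H}^2\Bigr]\le2c\,\mathbb E\bigl[\lVert\psi_{k+1}(Y^0_{n-1,j}-y)\rVert_{\mathcal H}^2\bigr].$$ Then (i) for all $n\in\mathbb N$: $\bigl(\mathbb E[\lVert\psi_0(Y^0_{n,n}-y)\rVert_{\mathcal H}^2]\bigr)^{1/2}\le C\bigl[\frac{\mathfrak b(1+4c)}{M_n}\bigr]^{n/2}<\infty$; (ii) for all $n\in\mathbb N$: $\mathrm{Cost}_{n,n}\le(3+\gamma)^n(M_n)^n\mathfrak z$; and (iii)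 there exists $(N_\varepsilon)_{\varepsilon\in(0,1]}\subseteq\mathbb N$ such that for all $\varepsilon\in(0,1]$, $\delta\in(0,\infty)$ it holds that $\sup_{n\in\{N_\varepsilon,N_\varepsilon+1,\ldots\}}\bigl(\mathbb E[\lVert\psi_0(Y^0_{n,n}-y)\rVert_{\mathcal H}^2]\bigr)^{1/2}\le\varepsilon$ and $$\mathrm{Cost}_{N_\varepsilon,N_\varepsilon}\le\mathfrak z\,\mathfrak b\,\mathfrak c_1(3+\gamma)C^{2(1+\delta)}\Bigl(1+\sup_{n\in\mathbb N}\Bigl[\frac{[\mathfrak B\mathfrak b^2(3+\gamma)(1+4c)]^{(1+\delta)}}{(M_n)^\delta}\Bigr]^n\Bigr)\varepsilon^{-2(1+\delta)}<\infty.$$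
   Context: $\mathbb N=\{1,2,3,\ldots\}$, $\mathbb N_0=\{0,1,2,\ldots\}$. For $\theta\in\mathbb Z^k\subseteq\Theta$ and $l,i\in\mathbb Z$, $(\theta,l,i)$ denotes the concatenated tuple in $\mathbb Z^{k+2}\subseteq\Theta$; the superscripts $0$ and $1$ denote the elements $0,1\in\mathbb Z^1\subseteq\Theta$. $\mathscr B(\cdot)$ is the Borel $\sigma$-algebra. $L(\mathcal Y,\mathcal H)$ is the space of continuous linear maps from $\mathcal Y$ to $\mathcal H$. For $\psi\colon\Omega\to L(\mathcal Y,\mathcal H)$ and $X\colon\Omega\to\mathcal Y$, $\psi(X)$ denotes the map $\omega\mapsto[\psi(\omega)](X(\omega))$. $\mathbb 1_{\mathbb N}(k)$ equals $1$ if $k\in\mathbb N$ and $0$ if $k=0$ (with $0\cdot\infty=0$). Expectations of $\mathcal Y$-valued random variables are Bochner integrals. *)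

theory Defs
  imports "HOL-Probability.Probability"
begin

text \<open>The index set \<open>\<Union>n\<ge>1. \<int>\<^sup>n\<close>: an \<open>n\<close>-tuple of integers is a list of length \<open>n\<close>, so that the
  concatenated tuple \<open>(\<theta>, l, i)\<close> is \<open>\<theta> @ [l, i]\<close> and the indices \<open>0, 1 \<in> \<int>\<^sup>1\<close> are \<open>[0], [1]\<close>.\<close>

definition Theta :: "int list set" where
  "Theta = {\<theta>. \<theta> \<noteq> []}"

text \<open>The \<open>\<sigma>\<close>-algebra on \<open>L(Y, H)\<close> generated by the evaluation maps; in general it is not the
  Borel \<open>\<sigma>\<close>-algebra of the operator norm topology.\<close>

definition strong_algebra ::
  "('y::real_normed_vector \<Rightarrow>\<^sub>L 'h::real_normed_vector) measure" where
  "strong_algebra = sigma UNIV {{\<phi>. blinfun_apply \<phi> x \<in> B} | x B. B \<in> sets borel}"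

definition generated_events ::
  "'w measure \<Rightarrow> 'i set \<Rightarrow> 'a measure \<Rightarrow> ('i \<Rightarrow> 'w \<Rightarrow> 'a) \<Rightarrow> 'w set set" where
  "generated_events P I N X =
     sigma_sets (space P) {X i -` A \<inter> space P | i A. i \<in> I \<and> A \<in> sets N}"

text \<open>Expectations of nonnegative quantities are taken in \<open>[0, \<infinity>]\<close>, since finiteness of the second
  moments is part of the claims; this also requires a square root on \<open>[0, \<infinity>]\<close>.\<close>

abbreviation second_moment :: "'w measure \<Rightarrow> ('w \<Rightarrow> 'h::real_normed_vector) \<Rightarrow> ennreal" where
  "second_moment P X \<equiv> (\<integral>\<^sup>+ \<omega>. ennreal ((norm (X \<omega>))\<^sup>2) \<partial>P)"

definition ennsqrt :: "ennreal \<Rightarrow> ennreal" where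
  "ennsqrt x = (if x = \<infinity> then \<infinity> else ennreal (sqrt (enn2real x)))"

lemma ennsqrt_power2: "(ennsqrt x)\<^sup>2 = x"
  by (cases x) (auto simp: ennsqrt_def power2_eq_square ennreal_mult_top simp flip: ennreal_mult)

end

theory Submission
  imports Defs
begin

text \<open>For a fixed operator \<open>\<phi>\<close>, the summands of \<open>Y\<^sub>n\<close> are pairwise independent, so the second moment of
  \<open>\<phi>(Y\<^sub>n - y)\<close> is at most the squared bias plus the sum of the weighted second moments of the summands.
  Since \<open>Y\<^sub>n\<close> is a measurable function of \<open>Z\<close>, integrating this over the law of \<open>\<psi>\<^sub>k\<close> and inserting the
  hypotheses gives, for \<open>e(k,n) = E \<bar>\<psi>\<^sub>k(Y\<^sub>n - y)\<bar>\<^sup>2\<close>, a recursion that expresses \<open>e(k,n)\<close> through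
  \<open>e(k+1,l)\<close>, \<open>l < n\<close>. After multiplication by \<open>M\<^bsup>k+n\<^esup>\<close> its
  coefficients are bounded independently of \<open>M\<close>, and \<open>(1+4c)\<^sup>n\<close> dominates the solution.
  For the complexity bound, \<open>N\<^sub>\<epsilon>\<close> is the least index from which on the error bound stays below \<open>\<epsilon>\<close>:
  at \<open>N\<^sub>\<epsilon> - 1\<close> the error bound exceeds \<open>\<epsilon>\<close>, and a power of this inequality is multiplied to the cost.\<close>

subsection \<open>Random operators and pairwise independent sums\<close>

text \<open>The obstacle is that all summands are hit by the same random operator, so their images
  are dependent even when the summands are not. Freezing the operator restores independence. This
  needs joint measurability of evaluation, although the \<sigma>-algebra on operators only makes
  evaluation at fixed vectors measurable; separability closes the gap. Origin of the constants:
  splitting \<open>Y [0] l - Y [1] (l - 1)\<close> at \<open>y\<close> turns \<open>c\<close> into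
  \<open>2 * c\<close> for each of two neighbouring levels, and the bias adds another
  \<open>2 * c\<close> at the top level. Every level from 1 on thus collects \<open>4 * c\<close>,
  whence the ratio \<open>1 + 4 * c\<close>. The numbers \<open>\<cc> k\<close> enter only through
  \<open>C^2 / \<cc> k \<le> C^2 * \<bb>^n / (M n)^k\<close> for \<open>k \<le> n\<close>. Hence the
  recursion is confined to the triangle where operator index plus level is at most \<open>n\<close>,
  with target the corner of operator index 0 and level \<open>n\<close>. In the complexity bound the
  inequality at the threshold is raised to the power \<open>2 * (1 + \<delta>)\<close>: the exponent
  2 would just cancel the growth of \<open>(M n)^n\<close>, and the excess leaves
  \<open>(M n)^(-\<delta> * n)\<close>, which beats every geometric constant.\<close>

lemma borel_measurable_blinfun_apply_strong [measurable]:
  fixes f :: "'a \<Rightarrow> 'y::{real_normed_vector, second_countable_topology} \<Rightarrow>\<^sub>L 'h::real_normed_vector"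
  assumes f: "f \<in> measurable N strong_algebra" and g: "g \<in> borel_measurable N"
  shows "(\<lambda>x. blinfun_apply (f x) (g x)) \<in> borel_measurable N"
proof -
  have eval: "(\<lambda>\<phi>. blinfun_apply \<phi> v) \<in> borel_measurable (strong_algebra :: ('y \<Rightarrow>\<^sub>L 'h) measure)" for v
    by (rule measurableI) (auto simp: strong_algebra_def space_measure_of_conv vimage_def
        intro!: in_measure_of)
  obtain F where F: "\<And>i. simple_function N (F i)"
    "\<And>x. x \<in> space N \<Longrightarrow> (\<lambda>i. F i x) \<longlonglongrightarrow> g x"
    using borel_measurable_implies_sequence_metric[OF g] by metis
  show ?thesis
  proof (rule borel_measurable_LIMSEQ_metric)
    fix i
    \<comment> \<open>A simple function has finitely many values, so on each of its level sets only
      evaluation at a fixed vector occurs. Continuity of each single operator then carries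
      measurability to the limit.\<close>
    show "(\<lambda>x. blinfun_apply (f x) (F i x)) \<in> borel_measurable N"
    proof (rule measurable_compose_countable'[where I="F i ` space N"])
      show "(\<lambda>x. blinfun_apply (f x) v) \<in> borel_measurable N" for v
        using measurable_compose[OF f eval] .
      show "F i \<in> measurable N (count_space (F i ` space N))"
        using F(1)[of i] by (simp add: measurable_count_space_eq2 simple_function_def)
      show "countable (F i ` space N)"
        using simple_functionD(1)[OF F(1)] by (rule countable_finite)
    qed
  next
    fix x assume "x \<in> space N"
    then show "(\<lambda>i. blinfun_apply (f x) (F i x)) \<longlonglongrightarrow> blinfun_apply (f x) (g x)"
      by (intro tendsto_intros F(2))
  qed
qed

context prob_space
begin

text \<open>The library's \<open>indep_var\<close> requires both random variables to have values in the same type.\<close>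

lemma distr_Pair_eq_pair_measure_distr:
  assumes [measurable]: "X \<in> measurable M S" "Y \<in> measurable M T"
    and indep: "indep_set {X -` A \<inter> space M | A. A \<in> sets S} {Y -` B \<inter> space M | B. B \<in> sets T}"
  shows "distr M (S \<Otimes>\<^sub>M T) (\<lambda>\<omega>. (X \<omega>, Y \<omega>)) = distr M S X \<Otimes>\<^sub>M distr M T Y"
proof -
  interpret X: prob_space "distr M S X" by (rule prob_space_distr) simp
  interpret Y: prob_space "distr M T Y" by (rule prob_space_distr) simp
  show ?thesis
  proof (rule sym, rule pair_measure_eqI)
    fix A B assume "A \<in> sets (distr M S X)" "B \<in> sets (distr M T Y)"
    then have [measurable]: "A \<in> sets S" "B \<in> sets T" by auto
    have eq: "(\<lambda>\<omega>. (X \<omega>, Y \<omega>)) -` (A \<times> B) \<inter> space M = (X -` A \<inter> space M) \<inter> (Y -` B \<inter> space M)"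
      by auto
    have "prob ((X -` A \<inter> space M) \<inter> (Y -` B \<inter> space M)) = prob (X -` A \<inter> space M) * prob (Y -` B \<inter> space M)"
      by (rule indep_setD[OF indep]) auto
    then show "emeasure (distr M S X) A * emeasure (distr M T Y) B =
        emeasure (distr M (S \<Otimes>\<^sub>M T) (\<lambda>\<omega>. (X \<omega>, Y \<omega>))) (A \<times> B)"
      by (simp add: emeasure_distr eq emeasure_eq_measure ennreal_mult)
  next
    show "sets (distr M S X \<Otimes>\<^sub>M distr M T Y) = sets (distr M (S \<Otimes>\<^sub>M T) (\<lambda>\<omega>. (X \<omega>, Y \<omega>)))"
      using sets_pair_measure_cong[of "distr M S X" S "distr M T Y" T] by simp
  qed (rule X.sigma_finite_measure_axioms Y.sigma_finite_measure_axioms)+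
qed

text \<open>The joint law is a product, and Tonelli in \<open>[0, \<infinity>]\<close> separates the
  operator from the vector without any moment assumption. The measurability claim is what later
  permits integrating estimates for fixed operators.\<close>

lemma second_moment_blinfun_apply_indep:
  fixes \<psi> :: "'a \<Rightarrow> 'y::{real_normed_vector, second_countable_topology} \<Rightarrow>\<^sub>L 'h::real_normed_vector"
  assumes \<psi> [measurable]: "\<psi> \<in> measurable M strong_algebra" and W [measurable]: "W \<in> borel_measurable M"
    and indep: "indep_set {\<psi> -` A \<inter> space M | A. A \<in> sets strong_algebra}
                  {W -` B \<inter> space M | B. B \<in> sets borel}"
  shows "second_moment M (\<lambda>\<omega>. blinfun_apply (\<psi> \<omega>) (W \<omega>)) =
     (\<integral>\<^sup>+ \<phi>. second_moment M (\<lambda>\<omega>. blinfun_apply \<phi> (W \<omega>)) \<partial>distr M strong_algebra \<psi>)"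
    and "(\<lambda>\<phi> :: 'y \<Rightarrow>\<^sub>L 'h. second_moment M (\<lambda>\<omega>. blinfun_apply \<phi> (W \<omega>))) \<in> borel_measurable strong_algebra"
proof -
  interpret W: prob_space "distr M borel W" by (rule prob_space_distr) simp
  have [measurable]: "(\<lambda>x. blinfun_apply (fst x) (snd x)) \<in>
      borel_measurable ((strong_algebra :: ('y \<Rightarrow>\<^sub>L 'h) measure) \<Otimes>\<^sub>M borel)"
    by (rule borel_measurable_blinfun_apply_strong) simp_all
  let ?f = "\<lambda>x :: ('y \<Rightarrow>\<^sub>L 'h) \<times> 'y. ennreal ((norm (blinfun_apply (fst x) (snd x)))\<^sup>2)"
  have [measurable]: "blinfun_apply \<phi> \<in> borel_measurable borel" for \<phi> :: "'y \<Rightarrow>\<^sub>L 'h"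
    by (intro borel_measurable_continuous_onI continuous_intros)
  have inner: "(\<integral>\<^sup>+ w. ?f (\<phi>, w) \<partial>distr M borel W) = second_moment M (\<lambda>\<omega>. blinfun_apply \<phi> (W \<omega>))" for \<phi>
    by (subst nn_integral_distr) simp_all
  have "second_moment M (\<lambda>\<omega>. blinfun_apply (\<psi> \<omega>) (W \<omega>)) =
      integral\<^sup>N (distr M (strong_algebra \<Otimes>\<^sub>M borel) (\<lambda>\<omega>. (\<psi> \<omega>, W \<omega>))) ?f"
    by (subst nn_integral_distr) simp_all
  also have "\<dots> = (\<integral>\<^sup>+ \<phi>. \<integral>\<^sup>+ w. ?f (\<phi>, w) \<partial>distr M borel W \<partial>distr M strong_algebra \<psi>)"
    by (subst distr_Pair_eq_pair_measure_distr[OF \<psi> W indep], subst W.nn_integral_fst) simp_all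
  finally show "second_moment M (\<lambda>\<omega>. blinfun_apply (\<psi> \<omega>) (W \<omega>)) =
     (\<integral>\<^sup>+ \<phi>. second_moment M (\<lambda>\<omega>. blinfun_apply \<phi> (W \<omega>)) \<partial>distr M strong_algebra \<psi>)"
    by (simp only: inner)
  have "(\<lambda>\<phi>. \<integral>\<^sup>+ w. ?f (\<phi>, w) \<partial>distr M borel W) \<in> borel_measurable strong_algebra"
    by (rule W.borel_measurable_nn_integral_fst) simp
  then show "(\<lambda>\<phi> :: 'y \<Rightarrow>\<^sub>L 'h. second_moment M (\<lambda>\<omega>. blinfun_apply \<phi> (W \<omega>))) \<in> borel_measurable strong_algebra"
    by (simp only: inner)
qed

section \<open>Bias and variance of pairwise independent sums in a Hilbert space\<close>

lemma integrable_of_square_integrable_norm: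
  fixes X :: "'a \<Rightarrow> 'h::{banach, second_countable_topology}"
  assumes [measurable]: "X \<in> borel_measurable M" and "integrable M (\<lambda>\<omega>. (norm (X \<omega>))\<^sup>2)"
  shows "integrable M X"
  using square_integrable_imp_integrable[of "\<lambda>\<omega>. norm (X \<omega>)"] assms by (simp add: integrable_norm_iff)

text \<open>By Cauchy-Schwarz the inner product is dominated by the product of the norms, which is
  integrable because the norms are independent. Fubini on the product law then applies, and
  integration commutes with the inner product in each argument. For centred variables this makes the
  mixed terms of a variance vanish.\<close>

lemma indep_var_integrable_inner:
  fixes X Y :: "'a \<Rightarrow> 'h::{real_inner, banach, second_countable_topology}"
  assumes indep: "indep_var borel X borel Y" and "integrable M X" "integrable M Y"
  shows "integrable M (\<lambda>\<omega>. X \<omega> \<bullet> Y \<omega>)"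
    and "expectation (\<lambda>\<omega>. X \<omega> \<bullet> Y \<omega>) = expectation X \<bullet> expectation Y"
proof -
  have [measurable]: "X \<in> borel_measurable M" "Y \<in> borel_measurable M"
    using assms by auto
  have "indep_var borel (norm \<circ> X) borel (norm \<circ> Y)"
    by (rule indep_var_compose[OF indep]) simp_all
  then have "integrable M (\<lambda>\<omega>. norm (X \<omega>) * norm (Y \<omega>))"
    using assms by (intro indep_var_integrable) (auto simp: comp_def)
  then show int: "integrable M (\<lambda>\<omega>. X \<omega> \<bullet> Y \<omega>)"
    by (rule Bochner_Integration.integrable_bound) (auto simp: Cauchy_Schwarz_ineq2)
  interpret X: prob_space "distr M borel X" by (rule prob_space_distr) simp
  interpret Y: prob_space "distr M borel Y" by (rule prob_space_distr) simp
  interpret pair_sigma_finite "distr M borel X" "distr M borel Y" ..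
  have law: "distr M (borel \<Otimes>\<^sub>M borel) (\<lambda>\<omega>. (X \<omega>, Y \<omega>)) = distr M borel X \<Otimes>\<^sub>M distr M borel Y"
    using indep unfolding indep_var_distribution_eq by simp
  let ?f = "\<lambda>x :: 'h \<times> 'h. fst x \<bullet> snd x"
  have "integrable (distr M (borel \<Otimes>\<^sub>M borel) (\<lambda>\<omega>. (X \<omega>, Y \<omega>))) ?f"
    using int by (subst integrable_distr_eq) simp_all
  then have int': "integrable (distr M borel X \<Otimes>\<^sub>M distr M borel Y) ?f"
    by (simp only: law)
  have "expectation (\<lambda>\<omega>. X \<omega> \<bullet> Y \<omega>) = integral\<^sup>L (distr M (borel \<Otimes>\<^sub>M borel) (\<lambda>\<omega>. (X \<omega>, Y \<omega>))) ?f"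
    by (subst integral_distr) simp_all
  also have "\<dots> = (\<integral>x. \<integral>y. ?f (x, y) \<partial>distr M borel Y \<partial>distr M borel X)"
    unfolding law by (rule integral_fst'[OF int', symmetric])
  also have "\<dots> = (\<integral>x. x \<bullet> expectation Y \<partial>distr M borel X)"
    using assms by (simp add: integral_distr)
  also have "\<dots> = expectation X \<bullet> expectation Y"
    using assms by (simp add: integral_distr)
  finally show "expectation (\<lambda>\<omega>. X \<omega> \<bullet> Y \<omega>) = expectation X \<bullet> expectation Y" .
qed


lemma second_moment_sum_pairwise_indep:
  fixes V :: "'i \<Rightarrow> 'a \<Rightarrow> 'h::{real_inner, banach, second_countable_topology}"
  assumes I: "finite I"
    and meas [measurable]: "\<And>i. i \<in> I \<Longrightarrow> V i \<in> borel_measurable M"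
    and sq: "\<And>i. i \<in> I \<Longrightarrow> integrable M (\<lambda>\<omega>. (norm (V i \<omega>))\<^sup>2)"
    and indep: "\<And>i j. i \<in> I \<Longrightarrow> j \<in> I \<Longrightarrow> i \<noteq> j \<Longrightarrow> indep_var borel (V i) borel (V j)"
  shows "integrable M (\<lambda>\<omega>. (norm ((\<Sum>i\<in>I. a i *\<^sub>R V i \<omega>) - d))\<^sup>2)"
    and "expectation (\<lambda>\<omega>. (norm ((\<Sum>i\<in>I. a i *\<^sub>R V i \<omega>) - d))\<^sup>2)
      \<le> (norm ((\<Sum>i\<in>I. a i *\<^sub>R expectation (V i)) - d))\<^sup>2
         + (\<Sum>i\<in>I. (a i)\<^sup>2 * expectation (\<lambda>\<omega>. (norm (V i \<omega>))\<^sup>2))"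
proof -
  define D where "D i \<omega> = V i \<omega> - expectation (V i)" for i \<omega>
  define m where "m = (\<Sum>i\<in>I. a i *\<^sub>R expectation (V i)) - d"
  have V_int: "integrable M (V i)" if "i \<in> I" for i
    by (rule integrable_of_square_integrable_norm[OF meas[OF that] sq[OF that]])
  have D_meas [measurable]: "D i \<in> borel_measurable M" if "i \<in> I" for i
    using meas[OF that] unfolding D_def[abs_def] by measurable
  have D_int: "integrable M (D i)" and D_mean: "expectation (D i) = 0" if "i \<in> I" for i
    using V_int[OF that] by (simp_all add: D_def[abs_def] prob_space)
  have D_sq: "(norm (D i \<omega>))\<^sup>2
      = (norm (V i \<omega>))\<^sup>2 - 2 * (V i \<omega> \<bullet> expectation (V i)) + (norm (expectation (V i)))\<^sup>2" for i \<omega>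
    by (simp add: D_def power2_norm_eq_inner inner_diff_left inner_diff_right inner_commute)
  have D_sq_int: "integrable M (\<lambda>\<omega>. (norm (D i \<omega>))\<^sup>2)" if "i \<in> I" for i
    using V_int[OF that] sq[OF that] by (simp add: D_sq)
  \<comment> \<open>The variance is the second moment minus the squared norm of the mean; that last
    term is dropped.\<close>
  have D_var: "expectation (\<lambda>\<omega>. (norm (D i \<omega>))\<^sup>2) \<le> expectation (\<lambda>\<omega>. (norm (V i \<omega>))\<^sup>2)" if "i \<in> I" for i
    using V_int[OF that] sq[OF that] by (simp add: D_sq prob_space dot_square_norm)
  have D_indep: "indep_var borel (D i) borel (D j)" if "i \<in> I" "j \<in> I" "i \<noteq> j" for i j
    using indep_var_compose[OF indep[OF that], of "\<lambda>x. x - expectation (V i)" borel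
        "\<lambda>x. x - expectation (V j)" borel] by (simp add: comp_def D_def[abs_def])
  have cov: "integrable M (\<lambda>\<omega>. D i \<omega> \<bullet> D j \<omega>) \<and> expectation (\<lambda>\<omega>. D i \<omega> \<bullet> D j \<omega>)
      = (if i = j then expectation (\<lambda>\<omega>. (norm (D i \<omega>))\<^sup>2) else 0)" if "i \<in> I" "j \<in> I" for i j
    using indep_var_integrable_inner[OF D_indep D_int D_int, of i j] D_sq_int[of i] D_mean[of i] that
    by (auto simp: power2_norm_eq_inner)
  \<comment> \<open>Split into the deterministic bias \<open>m\<close> and the centred sum. The
    linear term has mean zero, and of the double sum only the diagonal survives in expectation, so
    independence in pairs is enough.\<close>
  have expand: "(norm ((\<Sum>i\<in>I. a i *\<^sub>R V i \<omega>) - d))\<^sup>2 = (norm m)\<^sup>2 + 2 * (\<Sum>i\<in>I. a i * (m \<bullet> D i \<omega>))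
      + (\<Sum>i\<in>I. \<Sum>j\<in>I. a i * (a j * (D i \<omega> \<bullet> D j \<omega>)))" for \<omega>
  proof -
    define S where "S = (\<Sum>i\<in>I. a i *\<^sub>R D i \<omega>)"
    have "(\<Sum>i\<in>I. a i *\<^sub>R V i \<omega>) - d = m + S"
      by (simp add: S_def m_def D_def scaleR_diff_right sum_subtractf)
    then have "(norm ((\<Sum>i\<in>I. a i *\<^sub>R V i \<omega>) - d))\<^sup>2 = (norm m)\<^sup>2 + 2 * (m \<bullet> S) + S \<bullet> S"
      by (simp add: power2_norm_eq_inner inner_add_left inner_add_right inner_commute[of S m])
    moreover have "m \<bullet> S = (\<Sum>i\<in>I. a i * (m \<bullet> D i \<omega>))"
      by (simp add: S_def inner_sum_right)
    moreover have "S \<bullet> S = (\<Sum>i\<in>I. \<Sum>j\<in>I. a i * (a j * (D i \<omega> \<bullet> D j \<omega>)))"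
      unfolding S_def inner_sum_left by (simp add: inner_sum_right sum_distrib_left mult.left_commute)
    ultimately show ?thesis
      by simp
  qed
  show "integrable M (\<lambda>\<omega>. (norm ((\<Sum>i\<in>I. a i *\<^sub>R V i \<omega>) - d))\<^sup>2)"
    unfolding expand using D_int cov by auto
  have "expectation (\<lambda>\<omega>. (norm ((\<Sum>i\<in>I. a i *\<^sub>R V i \<omega>) - d))\<^sup>2)
      = (norm m)\<^sup>2 + 2 * (\<Sum>i\<in>I. a i * (m \<bullet> expectation (D i)))
        + (\<Sum>i\<in>I. \<Sum>j\<in>I. a i * (a j * expectation (\<lambda>\<omega>. D i \<omega> \<bullet> D j \<omega>)))"
    unfolding expand using D_int cov by (simp add: prob_space Bochner_Integration.integral_sum)
  also have "\<dots> = (norm m)\<^sup>2 + (\<Sum>i\<in>I. (a i)\<^sup>2 * expectation (\<lambda>\<omega>. (norm (D i \<omega>))\<^sup>2))"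
  proof -
    have "(\<Sum>j\<in>I. a i * (a j * expectation (\<lambda>\<omega>. D i \<omega> \<bullet> D j \<omega>)))
        = (a i)\<^sup>2 * expectation (\<lambda>\<omega>. (norm (D i \<omega>))\<^sup>2)" if "i \<in> I" for i
    proof -
      have "(\<Sum>j\<in>I. a i * (a j * expectation (\<lambda>\<omega>. D i \<omega> \<bullet> D j \<omega>)))
          = (\<Sum>j\<in>I. if i = j then (a i)\<^sup>2 * expectation (\<lambda>\<omega>. (norm (D i \<omega>))\<^sup>2) else 0)"
        using cov[OF that] by (intro sum.cong) (auto simp: power2_eq_square)
      then show ?thesis
        using I that by simp
    qed
    then show ?thesis
      using D_mean by simp
  qed
  also have "\<dots> \<le> (norm m)\<^sup>2 + (\<Sum>i\<in>I. (a i)\<^sup>2 * expectation (\<lambda>\<omega>. (norm (V i \<omega>))\<^sup>2))"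
    by (intro add_left_mono sum_mono mult_left_mono D_var) auto
  finally show "expectation (\<lambda>\<omega>. (norm ((\<Sum>i\<in>I. a i *\<^sub>R V i \<omega>) - d))\<^sup>2)
      \<le> (norm ((\<Sum>i\<in>I. a i *\<^sub>R expectation (V i)) - d))\<^sup>2
         + (\<Sum>i\<in>I. (a i)\<^sup>2 * expectation (\<lambda>\<omega>. (norm (V i \<omega>))\<^sup>2))"
    by (simp add: m_def)
qed

text \<open>The summands have only first moments, in a Banach space; their images under
  \<open>\<phi>\<close> may or may not be square integrable. If all are, the Hilbert space estimate
  applies, as \<open>\<phi>\<close> commutes with the expectation. If one is not, its nonzero weight
  makes the right-hand side infinite.\<close>

lemma second_moment_blinfun_sum_pairwise_indep:
  fixes X :: "'i \<Rightarrow> 'a \<Rightarrow> 'y::{banach, second_countable_topology}"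
    and \<phi> :: "'y \<Rightarrow>\<^sub>L 'h::{real_inner, banach, second_countable_topology}"
  assumes I: "finite I"
    and X: "\<And>i. i \<in> I \<Longrightarrow> integrable M (X i)"
    and indep: "\<And>i j. i \<in> I \<Longrightarrow> j \<in> I \<Longrightarrow> i \<noteq> j \<Longrightarrow> indep_var borel (X i) borel (X j)"
    and a: "\<And>i. i \<in> I \<Longrightarrow> a i \<noteq> 0"
  shows "second_moment M (\<lambda>\<omega>. \<phi> ((\<Sum>i\<in>I. a i *\<^sub>R X i \<omega>) - y))
     \<le> ennreal ((norm (\<phi> (y - (\<Sum>i\<in>I. a i *\<^sub>R expectation (X i)))))\<^sup>2)
       + (\<Sum>i\<in>I. ennreal ((a i)\<^sup>2) * second_moment M (\<lambda>\<omega>. \<phi> (X i \<omega>)))"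
proof (cases "\<forall>i\<in>I. second_moment M (\<lambda>\<omega>. \<phi> (X i \<omega>)) < \<infinity>")
  case True
  have [measurable]: "blinfun_apply \<phi> \<in> borel_measurable borel"
    by (intro borel_measurable_continuous_onI continuous_intros)
  have X_meas [measurable]: "X i \<in> borel_measurable M" if "i \<in> I" for i
    using X[OF that] by simp
  have meas [measurable]: "(\<lambda>\<omega>. \<phi> (X i \<omega>)) \<in> borel_measurable M" if "i \<in> I" for i
    using X_meas[OF that] by measurable
  have sq: "integrable M (\<lambda>\<omega>. (norm (\<phi> (X i \<omega>)))\<^sup>2)" if "i \<in> I" for i
    using True meas[OF that] that by (intro integrableI_bounded) auto
  have ind: "indep_var borel (\<lambda>\<omega>. \<phi> (X i \<omega>)) borel (\<lambda>\<omega>. \<phi> (X j \<omega>))" if "i \<in> I" "j \<in> I" "i \<noteq> j" for i j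
    using indep_var_compose[OF indep[OF that], of "blinfun_apply \<phi>" borel "blinfun_apply \<phi>" borel]
    by (simp add: comp_def)
  have mean: "expectation (\<lambda>\<omega>. \<phi> (X i \<omega>)) = \<phi> (expectation (X i))" if "i \<in> I" for i
    using X[OF that] by (intro integral_bounded_linear blinfun.bounded_linear_right)
  have \<phi>_sum: "\<phi> ((\<Sum>i\<in>I. a i *\<^sub>R x i) - y) = (\<Sum>i\<in>I. a i *\<^sub>R \<phi> (x i)) - \<phi> y" for x
    by (simp add: blinfun.diff_right blinfun.sum_right blinfun.scaleR_right)
  have nn: "second_moment M (\<lambda>\<omega>. \<phi> (X i \<omega>)) = ennreal (expectation (\<lambda>\<omega>. (norm (\<phi> (X i \<omega>)))\<^sup>2))"
    if "i \<in> I" for i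
    using sq[OF that] by (intro nn_integral_eq_integral) auto
  note * = second_moment_sum_pairwise_indep[of I "\<lambda>i \<omega>. \<phi> (X i \<omega>)" a "\<phi> y", OF I meas sq ind]
  have "second_moment M (\<lambda>\<omega>. \<phi> ((\<Sum>i\<in>I. a i *\<^sub>R X i \<omega>) - y))
      = ennreal (expectation (\<lambda>\<omega>. (norm ((\<Sum>i\<in>I. a i *\<^sub>R \<phi> (X i \<omega>)) - \<phi> y))\<^sup>2))"
    unfolding \<phi>_sum using *(1) by (intro nn_integral_eq_integral) auto
  also have "\<dots> \<le> ennreal ((norm ((\<Sum>i\<in>I. a i *\<^sub>R \<phi> (expectation (X i))) - \<phi> y))\<^sup>2
         + (\<Sum>i\<in>I. (a i)\<^sup>2 * expectation (\<lambda>\<omega>. (norm (\<phi> (X i \<omega>)))\<^sup>2)))"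
    using *(2) by (intro ennreal_leI) (simp add: mean)
  also have "\<dots> = ennreal ((norm (\<phi> (y - (\<Sum>i\<in>I. a i *\<^sub>R expectation (X i)))))\<^sup>2)
       + (\<Sum>i\<in>I. ennreal ((a i)\<^sup>2) * second_moment M (\<lambda>\<omega>. \<phi> (X i \<omega>)))"
    by (simp add: nn ennreal_plus sum_nonneg sum_ennreal[symmetric] ennreal_mult \<phi>_sum[symmetric]
        blinfun.diff_right norm_minus_commute cong: sum.cong)
  finally show ?thesis .
next
  case False
  then obtain i where i: "i \<in> I" "second_moment M (\<lambda>\<omega>. \<phi> (X i \<omega>)) = \<infinity>"
    by (auto simp: less_top[symmetric])
  then have "ennreal ((a i)\<^sup>2) * second_moment M (\<lambda>\<omega>. \<phi> (X i \<omega>)) = \<infinity>"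
    using a[OF i(1)] by (simp add: ennreal_mult_eq_top_iff)
  then have "(\<Sum>i\<in>I. ennreal ((a i)\<^sup>2) * second_moment M (\<lambda>\<omega>. \<phi> (X i \<omega>))) = \<infinity>"
    using I i(1) by (auto simp: ennreal_sum_eq_top)
  then show ?thesis
    by (simp add: add_top)
qed

end

subsection \<open>The multilevel Picard scheme as a function of the driving family\<close>

text \<open>The scheme is prescribed only on \<open>space P\<close>, so its representation through
  \<open>Z\<close> is an identity there and not an equality of functions.\<close>

lemma (in prob_space) indep_var_cong_space:
  assumes "indep_var S X T Y"
    and "\<And>\<omega>. \<omega> \<in> space M \<Longrightarrow> X \<omega> = X' \<omega>" "\<And>\<omega>. \<omega> \<in> space M \<Longrightarrow> Y \<omega> = Y' \<omega>"
  shows "indep_var S X' T Y'"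
proof -
  have "X -` A \<inter> space M = X' -` A \<inter> space M" "Y -` A \<inter> space M = Y' -` A \<inter> space M" for A
    using assms(2,3) by auto
  moreover have "random_variable S X \<longleftrightarrow> random_variable S X'" "random_variable T Y \<longleftrightarrow> random_variable T Y'"
    using assms(2,3) by (auto intro: measurable_cong cong: measurable_cong)
  ultimately show ?thesis
    using assms(1) by (simp add: indep_var_eq)
qed

lemma measurable_PiM_reindex:
  assumes "range r \<subseteq> A"
  shows "(\<lambda>z u. z (r u)) \<in> measurable (\<Pi>\<^sub>M i\<in>A. N) (\<Pi>\<^sub>M u\<in>UNIV. N)"
proof (rule measurable_PiM_single')
  show "(\<lambda>z. z (r u)) \<in> measurable (\<Pi>\<^sub>M i\<in>A. N) N" for u
    using assms by (intro measurable_component_singleton) auto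
  then show "(\<lambda>z u. z (r u)) \<in> space (\<Pi>\<^sub>M i\<in>A. N) \<rightarrow> (\<Pi>\<^sub>E u\<in>UNIV. space N)"
    by (auto dest: measurable_space)
qed

lemma append_in_Theta: "\<theta> \<in> Theta \<Longrightarrow> \<theta> @ \<eta> \<in> Theta"
  by (simp add: Theta_def)

text \<open>The recursion for \<open>Y\<close> never changes the second index \<open>j\<close>, so
  laws and independence can be studied for one frozen \<open>j\<close> with \<open>m\<close>
  standing for \<open>M j\<close>. The diagonal choice \<open>j = n\<close> is made only on
  instantiation.\<close>

locale multilevel_picard = prob_space P for P :: "'w measure" +
  fixes Zs :: "'z measure"
    and Z :: "int list \<Rightarrow> 'w \<Rightarrow> 'z"
    and \<Phi> :: "nat \<Rightarrow> 'y \<times> 'y \<times> 'z \<Rightarrow> 'y :: {banach, second_countable_topology}"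
    and ym y0 :: 'y
    and m :: nat
    and Y :: "int list \<Rightarrow> int \<Rightarrow> 'w \<Rightarrow> 'y"
  assumes Z_measurable: "\<theta> \<in> Theta \<Longrightarrow> Z \<theta> \<in> measurable P Zs"
    and Z_indep: "indep_vars (\<lambda>_. Zs) Z Theta"
    and Z_law: "\<theta> \<in> Theta \<Longrightarrow> \<eta> \<in> Theta \<Longrightarrow> distr P Zs (Z \<theta>) = distr P Zs (Z \<eta>)"
    and \<Phi>_measurable [measurable]: "\<Phi> l \<in> measurable (borel \<Otimes>\<^sub>M borel \<Otimes>\<^sub>M Zs) borel"
    and m_pos: "1 \<le> m"
    and Y_minus_one: "\<theta> \<in> Theta \<Longrightarrow> \<omega> \<in> space P \<Longrightarrow> Y \<theta> (-1) \<omega> = ym"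
    and Y_zero: "\<theta> \<in> Theta \<Longrightarrow> \<omega> \<in> space P \<Longrightarrow> Y \<theta> 0 \<omega> = y0"
    and Y_pos: "\<theta> \<in> Theta \<Longrightarrow> 1 \<le> n \<Longrightarrow> \<omega> \<in> space P \<Longrightarrow>
           Y \<theta> (int n) \<omega> =
             (\<Sum>l = 0..<n. (1 / real m ^ (n - l)) *\<^sub>R
                (\<Sum>i = 1..m ^ (n - l).
                   \<Phi> l (Y (\<theta> @ [int l, int i]) (int l) \<omega>,
                        Y (\<theta> @ [- int l, int i]) (int l - 1) \<omega>,
                        Z (\<theta> @ [int l, int i]) \<omega>)))"
begin

text \<open>The functional \<open>F\<close> is the same for all \<open>\<theta>\<close>: the
  recursion sees \<open>\<theta>\<close> only as a prefix, so \<open>Y\<close> at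
  \<open>\<theta>\<close> evaluates a fixed function on the subtree of \<open>Z\<close> below
  \<open>\<theta>\<close>. Equality in law, independence and measurability all follow from this. The
  shift \<open>int k - 1\<close> brings the level -1 into an induction over natural numbers.\<close>

lemma Y_functional:
  "\<exists>F \<in> borel_measurable (\<Pi>\<^sub>M \<eta>\<in>UNIV. Zs).
     \<forall>\<theta>\<in>Theta. \<forall>\<omega>\<in>space P. Y \<theta> (int k - 1) \<omega> = F (\<lambda>\<eta>. Z (\<theta> @ \<eta>) \<omega>)"
proof (induction k rule: less_induct)
  case (less k)
  consider "k = 0" | "k = 1" | "k \<ge> 2" by linarith
  then show ?case
  proof cases
    case 1
    then show ?thesis
      using Y_minus_one by (intro bexI[of _ "\<lambda>_. ym"]) auto
  next
    case 2
    then show ?thesis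
      using Y_zero by (intro bexI[of _ "\<lambda>_. y0"]) auto
  next
    case 3
    define n where "n = k - 1"
    have n: "1 \<le> n" "int k - 1 = int n" "\<And>l. l < n \<Longrightarrow> l < k \<and> Suc l < k"
      using 3 by (auto simp: n_def)
    have "\<forall>l. \<exists>F. l < k \<longrightarrow> F \<in> borel_measurable (\<Pi>\<^sub>M \<eta>\<in>UNIV. Zs) \<and>
        (\<forall>\<theta>\<in>Theta. \<forall>\<omega>\<in>space P. Y \<theta> (int l - 1) \<omega> = F (\<lambda>\<eta>. Z (\<theta> @ \<eta>) \<omega>))"
      using less.IH by blast
    then obtain G where G: "\<And>l. l < k \<Longrightarrow> G l \<in> borel_measurable (\<Pi>\<^sub>M \<eta>\<in>UNIV. Zs)"
      "\<And>l \<theta> \<omega>. l < k \<Longrightarrow> \<theta> \<in> Theta \<Longrightarrow> \<omega> \<in> space P \<Longrightarrow> Y \<theta> (int l - 1) \<omega> = G l (\<lambda>\<eta>. Z (\<theta> @ \<eta>) \<omega>)"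
      by metis
    \<comment> \<open>The recursion rewritten for families indexed by suffixes. Because of the
      shift, level \<open>l\<close> is represented by \<open>G (Suc l)\<close> and level
      \<open>l - 1\<close> by \<open>G l\<close>.\<close>
    define F where "F = (\<lambda>z. \<Sum>l = 0..<n. (1 / real m ^ (n - l)) *\<^sub>R (\<Sum>i = 1..m ^ (n - l).
        \<Phi> l (G (Suc l) (\<lambda>\<eta>. z ([int l, int i] @ \<eta>)), G l (\<lambda>\<eta>. z ([- int l, int i] @ \<eta>)), z [int l, int i])))"
    have "(\<lambda>z. G l (\<lambda>\<eta>. z (p @ \<eta>))) \<in> borel_measurable (\<Pi>\<^sub>M \<eta>\<in>UNIV. Zs)" if "l < k" for l p
      using measurable_compose[OF measurable_PiM_reindex G(1)[OF that], of "\<lambda>\<eta>. p @ \<eta>" UNIV] by simp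
    moreover have "(\<lambda>z. z p) \<in> measurable (\<Pi>\<^sub>M \<eta>\<in>UNIV. Zs) Zs" for p :: "int list"
      by (intro measurable_component_singleton) simp
    ultimately have "F \<in> borel_measurable (\<Pi>\<^sub>M \<eta>\<in>UNIV. Zs)"
      unfolding F_def using n(3)
      by (intro borel_measurable_sum borel_measurable_scaleR borel_measurable_const
          measurable_compose[OF _ \<Phi>_measurable] measurable_Pair)
        (auto simp del: append.simps)
    moreover have "Y \<theta> (int k - 1) \<omega> = F (\<lambda>\<eta>. Z (\<theta> @ \<eta>) \<omega>)" if "\<theta> \<in> Theta" "\<omega> \<in> space P" for \<theta> \<omega>
    proof -
      have "Y (\<theta> @ p) (int l) \<omega> = G (Suc l) (\<lambda>\<eta>. Z (\<theta> @ p @ \<eta>) \<omega>)"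
        "Y (\<theta> @ p) (int l - 1) \<omega> = G l (\<lambda>\<eta>. Z (\<theta> @ p @ \<eta>) \<omega>)" if "l < n" for l p
        using G(2)[of "Suc l" "\<theta> @ p" \<omega>] G(2)[of l "\<theta> @ p" \<omega>] n(3)[OF that]
          append_in_Theta[OF \<open>\<theta> \<in> Theta\<close>] \<open>\<omega> \<in> space P\<close> by auto
      then show ?thesis
        unfolding n(2) F_def using Y_pos[OF that(1) n(1) that(2)] by simp
    qed
    ultimately show ?thesis by blast
  qed
qed

text \<open>Both indices are parameters, so that the summands of the scheme and the variable with
  indices \<open>[0]\<close> and \<open>[1]\<close> in the hypotheses are instances of one
  expression.\<close>

definition sample :: "nat \<Rightarrow> int list \<Rightarrow> int list \<Rightarrow> 'w \<Rightarrow> 'y" where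
  "sample l p q \<omega> = \<Phi> l (Y p (int l) \<omega>, Y q (int l - 1) \<omega>, Z p \<omega>)"

lemma sample_zero:
  "p \<in> Theta \<Longrightarrow> q \<in> Theta \<Longrightarrow> \<omega> \<in> space P \<Longrightarrow> sample 0 p q \<omega> = \<Phi> 0 (y0, ym, Z p \<omega>)"
  by (simp add: sample_def Y_zero Y_minus_one)

text \<open>A sample depends on the two subtrees of \<open>Z\<close> with roots \<open>p\<close> and
  \<open>q\<close>; the Boolean tells which subtree a suffix belongs to. This gives all samples of
  one level a common index set.\<close>

definition paired_index :: "int list \<Rightarrow> int list \<Rightarrow> bool \<times> int list \<Rightarrow> int list" where
  "paired_index p q u = (if fst u then p else q) @ snd u"

text \<open>Distinct lists of equal length are not prefixes of one another, so the two subtrees are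
  disjoint.\<close>

lemma inj_paired_index: "length p = length q \<Longrightarrow> p \<noteq> q \<Longrightarrow> inj (paired_index p q)"
  by (auto simp: inj_def paired_index_def split: if_splits)

lemma sample_functional:
  "\<exists>K \<in> borel_measurable (\<Pi>\<^sub>M u\<in>UNIV. Zs).
     \<forall>p\<in>Theta. \<forall>q\<in>Theta. \<forall>\<omega>\<in>space P. sample l p q \<omega> = K (\<lambda>u. Z (paired_index p q u) \<omega>)"
proof -
  obtain F G where F: "F \<in> borel_measurable (\<Pi>\<^sub>M \<eta>\<in>UNIV. Zs)"
      "\<And>\<theta> \<omega>. \<theta> \<in> Theta \<Longrightarrow> \<omega> \<in> space P \<Longrightarrow> Y \<theta> (int l) \<omega> = F (\<lambda>\<eta>. Z (\<theta> @ \<eta>) \<omega>)"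
    and G: "G \<in> borel_measurable (\<Pi>\<^sub>M \<eta>\<in>UNIV. Zs)"
      "\<And>\<theta> \<omega>. \<theta> \<in> Theta \<Longrightarrow> \<omega> \<in> space P \<Longrightarrow> Y \<theta> (int l - 1) \<omega> = G (\<lambda>\<eta>. Z (\<theta> @ \<eta>) \<omega>)"
    using Y_functional[of "Suc l"] Y_functional[of l] by auto
  define K where "K = (\<lambda>z. \<Phi> l (F (\<lambda>\<eta>. z (True, \<eta>)), G (\<lambda>\<eta>. z (False, \<eta>)), z (True, [])))"
  have "(\<lambda>z. H (\<lambda>\<eta>. z (b, \<eta>))) \<in> borel_measurable (\<Pi>\<^sub>M u\<in>UNIV. Zs)"
    if "H \<in> borel_measurable (\<Pi>\<^sub>M \<eta>\<in>UNIV. Zs)" for b :: bool and H :: "(int list \<Rightarrow> 'z) \<Rightarrow> 'y"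
    using measurable_compose[OF measurable_PiM_reindex that, of "\<lambda>\<eta>. (b, \<eta>)" UNIV] by simp
  then have "K \<in> borel_measurable (\<Pi>\<^sub>M u\<in>UNIV. Zs)"
    unfolding K_def using F(1) G(1)
    by (intro measurable_compose[OF _ \<Phi>_measurable] measurable_Pair measurable_component_singleton) auto
  moreover have "sample l p q \<omega> = K (\<lambda>u. Z (paired_index p q u) \<omega>)"
    if "p \<in> Theta" "q \<in> Theta" "\<omega> \<in> space P" for p q \<omega>
    using that by (simp add: sample_def K_def F(2) G(2) paired_index_def)
  ultimately show ?thesis by blast
qed

section \<open>Equality in law and independence of samples\<close>

lemma distr_reindex:
  assumes "inj r" "range r \<subseteq> Theta"
  shows "distr P (\<Pi>\<^sub>M u\<in>UNIV. Zs) (\<lambda>\<omega> u. Z (r u) \<omega>) = (\<Pi>\<^sub>M u\<in>UNIV. distr P Zs (Z [0]))"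
proof -
  let ?\<mu> = "distr P Zs (Z [0])"
  have Theta0: "[0] \<in> Theta"
    by (simp add: Theta_def)
  have sets: "sets (\<Pi>\<^sub>M i\<in>A. ?\<mu>) = sets (\<Pi>\<^sub>M i\<in>A. Zs)" for A :: "'i set"
    by (rule sets_PiM_cong) simp_all
  have "distr P (\<Pi>\<^sub>M i\<in>Theta. Zs) (\<lambda>\<omega>. \<lambda>i\<in>Theta. Z i \<omega>) = (\<Pi>\<^sub>M i\<in>Theta. distr P Zs (Z i))"
    using indep_vars_iff_distr_eq_PiM'[of Theta Z "\<lambda>_. Zs"] Z_indep Z_measurable Theta0 by auto
  also have "\<dots> = (\<Pi>\<^sub>M i\<in>Theta. ?\<mu>)"
    by (intro PiM_cong refl Z_law Theta0)
  finally have law: "distr P (\<Pi>\<^sub>M i\<in>Theta. Zs) (\<lambda>\<omega>. \<lambda>i\<in>Theta. Z i \<omega>) = (\<Pi>\<^sub>M i\<in>Theta. ?\<mu>)" .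
  have "distr P (\<Pi>\<^sub>M u\<in>UNIV. Zs) (\<lambda>\<omega> u. Z (r u) \<omega>)
      = distr (distr P (\<Pi>\<^sub>M i\<in>Theta. Zs) (\<lambda>\<omega>. \<lambda>i\<in>Theta. Z i \<omega>)) (\<Pi>\<^sub>M u\<in>UNIV. Zs) (\<lambda>z u. z (r u))"
  proof (subst distr_distr)
    show "(\<lambda>z u. z (r u)) \<in> measurable (\<Pi>\<^sub>M i\<in>Theta. Zs) (\<Pi>\<^sub>M u\<in>UNIV. Zs)"
      by (rule measurable_PiM_reindex[OF assms(2)])
    show "(\<lambda>\<omega>. \<lambda>i\<in>Theta. Z i \<omega>) \<in> measurable P (\<Pi>\<^sub>M i\<in>Theta. Zs)"
      by (intro measurable_restrict Z_measurable)
  qed (use assms(2) in \<open>auto simp: comp_def image_subset_iff intro!: distr_cong\<close>)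
  also have "\<dots> = distr (\<Pi>\<^sub>M i\<in>Theta. ?\<mu>) (\<Pi>\<^sub>M u\<in>UNIV. ?\<mu>) (\<lambda>z. \<lambda>u\<in>UNIV. z (r u))"
    unfolding law by (rule distr_cong) (simp_all add: sets restrict_def)
  also have "\<dots> = (\<Pi>\<^sub>M u\<in>UNIV. ?\<mu>)"
    using assms Z_measurable[OF Theta0] by (intro distr_PiM_reindex prob_space_distr) auto
  finally show ?thesis .
qed

lemma measurable_Z_reindex:
  assumes "range r \<subseteq> Theta"
  shows "(\<lambda>\<omega> u. Z (r u) \<omega>) \<in> measurable P (\<Pi>\<^sub>M u\<in>UNIV. Zs)"
proof (rule measurable_PiM_single')
  show "Z (r u) \<in> measurable P Zs" for u
    using assms by (intro Z_measurable) auto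
  then show "(\<lambda>\<omega> u. Z (r u) \<omega>) \<in> space P \<rightarrow> (\<Pi>\<^sub>E u\<in>UNIV. space Zs)"
    by (auto dest: measurable_space)
qed

text \<open>The right-hand side does not mention \<open>r\<close>: an injective selection from an
  i.i.d. family again has the product law. Two variables therefore have the same law once they are
  given by the same \<open>F\<close> along injective reindexings.\<close>

lemma functional_law:
  assumes "inj r" "range r \<subseteq> Theta" and F: "F \<in> borel_measurable (\<Pi>\<^sub>M u\<in>UNIV. Zs)"
    and W: "\<And>\<omega>. \<omega> \<in> space P \<Longrightarrow> W \<omega> = F (\<lambda>u. Z (r u) \<omega>)"
  shows "distr P borel W = distr (\<Pi>\<^sub>M u\<in>UNIV. distr P Zs (Z [0])) borel F"
proof -
  have "distr P borel W = distr (distr P (\<Pi>\<^sub>M u\<in>UNIV. Zs) (\<lambda>\<omega> u. Z (r u) \<omega>)) borel F"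
    by (subst distr_distr[OF F measurable_Z_reindex[OF assms(2)]])
      (auto simp: W intro!: distr_cong)
  then show ?thesis
    by (simp only: distr_reindex[OF assms(1,2)])
qed

lemma Y_law:
  assumes "\<theta> \<in> Theta"
  shows "distr P borel (Y \<theta> (int k - 1)) = distr P borel (Y [0] (int k - 1))"
proof -
  obtain F where F: "F \<in> borel_measurable (\<Pi>\<^sub>M \<eta>\<in>UNIV. Zs)"
    "\<And>\<theta> \<omega>. \<theta> \<in> Theta \<Longrightarrow> \<omega> \<in> space P \<Longrightarrow> Y \<theta> (int k - 1) \<omega> = F (\<lambda>\<eta>. Z (\<theta> @ \<eta>) \<omega>)"
    using Y_functional[of k] by blast
  have "distr P borel (Y \<theta> (int k - 1)) = distr (\<Pi>\<^sub>M u\<in>UNIV. distr P Zs (Z [0])) borel F"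
    if "\<theta> \<in> Theta" for \<theta>
    using that by (intro functional_law[of "\<lambda>\<eta>. \<theta> @ \<eta>"] F) (auto simp: inj_def append_in_Theta)
  then show ?thesis
    using assms by (simp add: Theta_def)
qed

lemma sample_law:
  assumes "p \<in> Theta" "q \<in> Theta" "length p = length q" "p \<noteq> q"
  shows "distr P borel (sample l p q) = distr P borel (sample l [0] [1])"
proof -
  obtain K where K: "K \<in> borel_measurable (\<Pi>\<^sub>M \<eta>\<in>UNIV. Zs)"
    "\<And>p q \<omega>. p \<in> Theta \<Longrightarrow> q \<in> Theta \<Longrightarrow> \<omega> \<in> space P \<Longrightarrow> sample l p q \<omega> = K (\<lambda>u. Z (paired_index p q u) \<omega>)"
    using sample_functional[of l] by blast
  have "distr P borel (sample l p q) = distr (\<Pi>\<^sub>M u\<in>UNIV. distr P Zs (Z [0])) borel K"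
    if "p \<in> Theta" "q \<in> Theta" "length p = length q" "p \<noteq> q" for p q
    using that by (intro functional_law[of "paired_index p q"] K inj_paired_index)
      (auto simp: paired_index_def append_in_Theta)
  from this[OF assms] this[of "[0]" "[1]"] show ?thesis
    by (simp add: Theta_def)
qed

text \<open>All four roots have the same length, so lists that extend different roots differ.
  Disjoint root pairs thus use disjoint parts of the independent family \<open>Z\<close>.\<close>

lemma sample_indep:
  assumes "p \<in> Theta" "q \<in> Theta" "p' \<in> Theta" "q' \<in> Theta"
    and "length q = length p" "length p' = length p" "length q' = length p"
    and "{p, q} \<inter> {p', q'} = {}"
  shows "indep_var borel (sample l p q) borel (sample l' p' q')"
proof -
  \<comment> \<open>Independence is available for restrictions of \<open>Z\<close> to disjoint index
    sets, so the functional is moved from the abstract index set to the range of indices that it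
    reads.\<close>
  have K: "\<exists>K \<in> borel_measurable (\<Pi>\<^sub>M i\<in>range (paired_index p q). Zs).
      \<forall>\<omega>\<in>space P. K (\<lambda>i\<in>range (paired_index p q). Z i \<omega>) = sample l p q \<omega>"
    if "p \<in> Theta" "q \<in> Theta" for l p q
  proof -
    obtain K where K: "K \<in> borel_measurable (\<Pi>\<^sub>M \<eta>\<in>UNIV. Zs)"
      "\<And>\<omega>. \<omega> \<in> space P \<Longrightarrow> sample l p q \<omega> = K (\<lambda>u. Z (paired_index p q u) \<omega>)"
      using sample_functional[of l] \<open>p \<in> Theta\<close> \<open>q \<in> Theta\<close> by blast
    then show ?thesis
      using measurable_compose[OF measurable_PiM_reindex K(1), of "paired_index p q" "range (paired_index p q)"]
      by (intro bexI[of _ "\<lambda>z. K (\<lambda>u. z (paired_index p q u))"]) auto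
  qed
  obtain K K' where K: "K \<in> borel_measurable (\<Pi>\<^sub>M i\<in>range (paired_index p q). Zs)"
      "\<And>\<omega>. \<omega> \<in> space P \<Longrightarrow> K (\<lambda>i\<in>range (paired_index p q). Z i \<omega>) = sample l p q \<omega>"
    and K': "K' \<in> borel_measurable (\<Pi>\<^sub>M i\<in>range (paired_index p' q'). Zs)"
      "\<And>\<omega>. \<omega> \<in> space P \<Longrightarrow> K' (\<lambda>i\<in>range (paired_index p' q'). Z i \<omega>) = sample l' p' q' \<omega>"
    using K[OF assms(1,2), of l] K[OF assms(3,4), of l'] by blast
  have disj: "range (paired_index p q) \<inter> range (paired_index p' q') = {}"
  proof (rule equals0I)
    fix i assume "i \<in> range (paired_index p q) \<inter> range (paired_index p' q')"
    then obtain u v where uv: "i = paired_index p q u" "i = paired_index p' q' v" by blast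
    define a b where "a = (if fst u then p else q)" and "b = (if fst v then p' else q')"
    have "a \<in> {p, q}" "b \<in> {p', q'}"
      by (simp_all add: a_def b_def)
    then have "length a = length b" "a \<noteq> b"
      using assms(5-8) by auto
    moreover have "a @ snd u = b @ snd v"
      using uv by (simp add: paired_index_def a_def b_def)
    ultimately show False by simp
  qed
  have "range (paired_index p q) \<subseteq> Theta" "range (paired_index p' q') \<subseteq> Theta"
    using assms(1-4) by (auto simp: paired_index_def append_in_Theta)
  from indep_var_compose[OF indep_var_restrict[OF Z_indep disj this] K(1) K'(1)]
  show ?thesis
    by (rule indep_var_cong_space) (simp_all add: K(2) K'(2))
qed

section \<open>Freezing the random operator\<close>

lemma functional_events:
  assumes "range r \<subseteq> Theta" and F: "F \<in> borel_measurable (\<Pi>\<^sub>M u\<in>UNIV. Zs)"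
    and W: "\<And>\<omega>. \<omega> \<in> space P \<Longrightarrow> W \<omega> = F (\<lambda>u. Z (r u) \<omega>)"
  shows "{W -` B \<inter> space P | B. B \<in> sets borel} \<subseteq> generated_events P Theta Zs Z"
proof -
  \<comment> \<open>Independence from the operators is assumed for the events generated by
    \<open>Z\<close>. Measurability of \<open>W\<close> with respect to \<open>P\<close> says
    nothing about these, so it is re-established on the space that carries only this
    \<sigma>-algebra.\<close>
  define Q where "Q = sigma (space P) {Z i -` A \<inter> space P | i A. i \<in> Theta \<and> A \<in> sets Zs}"
  have Q: "space Q = space P" "sets Q = generated_events P Theta Zs Z"
    unfolding Q_def generated_events_def by (auto intro!: space_measure_of sets_measure_of)
  have ZQ: "Z \<theta> \<in> measurable Q Zs" if "\<theta> \<in> Theta" for \<theta>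
  proof (rule measurableI)
    show "Z \<theta> \<omega> \<in> space Zs" if "\<omega> \<in> space Q" for \<omega>
      using measurable_space[OF Z_measurable[OF \<open>\<theta> \<in> Theta\<close>]] that by (simp add: Q)
    show "Z \<theta> -` A \<inter> space Q \<in> sets Q" if "A \<in> sets Zs" for A
      unfolding Q generated_events_def using that \<open>\<theta> \<in> Theta\<close> by (intro sigma_sets.Basic) auto
  qed
  have "(\<lambda>\<omega> u. Z (r u) \<omega>) \<in> measurable Q (\<Pi>\<^sub>M u\<in>UNIV. Zs)"
  proof (rule measurable_PiM_single')
    show "Z (r u) \<in> measurable Q Zs" for u
      using assms(1) by (intro ZQ) auto
    then show "(\<lambda>\<omega> u. Z (r u) \<omega>) \<in> space Q \<rightarrow> (\<Pi>\<^sub>E u\<in>UNIV. space Zs)"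
      by (auto dest: measurable_space)
  qed
  from measurable_compose[OF this F] have "W \<in> borel_measurable Q"
    by (rule measurable_cong[THEN iffD1, rotated]) (simp add: W Q)
  then show ?thesis
    using measurable_sets[of W Q borel] by (auto simp: Q)
qed


text \<open>Whatever is a function of \<open>Z\<close> is independent of \<open>\<psi>\<close>,
  hence its second moment under the random operator is the average over frozen operators.\<close>

lemma second_moment_functional:
  fixes \<psi> :: "'w \<Rightarrow> 'y \<Rightarrow>\<^sub>L 'h :: {real_inner, banach, second_countable_topology}"
  assumes \<psi>: "\<psi> \<in> measurable P strong_algebra"
    and indep: "indep_set (generated_events P Theta Zs Z) {\<psi> -` A \<inter> space P | A. A \<in> sets strong_algebra}"
    and r: "range r \<subseteq> Theta" and F: "F \<in> borel_measurable (\<Pi>\<^sub>M u\<in>UNIV. Zs)"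
    and W: "\<And>\<omega>. \<omega> \<in> space P \<Longrightarrow> W \<omega> = F (\<lambda>u. Z (r u) \<omega>)"
  shows "W \<in> borel_measurable P"
    and "second_moment P (\<lambda>\<omega>. blinfun_apply (\<psi> \<omega>) (W \<omega>)) =
     (\<integral>\<^sup>+ \<phi>. second_moment P (\<lambda>\<omega>. blinfun_apply \<phi> (W \<omega>)) \<partial>distr P strong_algebra \<psi>)"
    and "(\<lambda>\<phi> :: 'y \<Rightarrow>\<^sub>L 'h. second_moment P (\<lambda>\<omega>. blinfun_apply \<phi> (W \<omega>))) \<in> borel_measurable strong_algebra"
proof -
  show meas: "W \<in> borel_measurable P"
    using measurable_compose[OF measurable_Z_reindex[OF r] F]
    by (rule measurable_cong[THEN iffD1, rotated]) (simp add: W)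
  have "indep_set {\<psi> -` A \<inter> space P | A. A \<in> sets strong_algebra} {W -` B \<inter> space P | B. B \<in> sets borel}"
    using indep functional_events[of r F W] r F W unfolding indep_sets2_eq
    by (metis (no_types, lifting) Int_commute mult.commute subset_iff)
  from second_moment_blinfun_apply_indep[OF \<psi> meas this]
  show "second_moment P (\<lambda>\<omega>. blinfun_apply (\<psi> \<omega>) (W \<omega>)) =
     (\<integral>\<^sup>+ \<phi>. second_moment P (\<lambda>\<omega>. blinfun_apply \<phi> (W \<omega>)) \<partial>distr P strong_algebra \<psi>)"
    and "(\<lambda>\<phi> :: 'y \<Rightarrow>\<^sub>L 'h. second_moment P (\<lambda>\<omega>. blinfun_apply \<phi> (W \<omega>))) \<in> borel_measurable strong_algebra"
    by blast+
qed

lemma second_moment_eq_distr: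
  fixes \<phi> :: "'y \<Rightarrow>\<^sub>L 'h :: real_normed_vector"
  assumes "W \<in> borel_measurable P"
  shows "second_moment P (\<lambda>\<omega>. \<phi> (W \<omega>)) = second_moment (distr P borel W) (\<lambda>x. \<phi> x)"
proof -
  have [measurable]: "blinfun_apply \<phi> \<in> borel_measurable borel"
    by (intro borel_measurable_continuous_onI continuous_intros)
  show ?thesis
    using assms by (subst nn_integral_distr) simp_all
qed

lemma Y_minus_functional:
  "\<exists>F \<in> borel_measurable (\<Pi>\<^sub>M \<eta>\<in>UNIV. Zs).
     \<forall>\<theta>\<in>Theta. \<forall>\<omega>\<in>space P. Y \<theta> (int k - 1) \<omega> - y = F (\<lambda>\<eta>. Z (\<theta> @ \<eta>) \<omega>)"
proof -
  obtain F where "F \<in> borel_measurable (\<Pi>\<^sub>M \<eta>\<in>UNIV. Zs)"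
    and F: "\<And>\<theta> \<omega>. \<theta> \<in> Theta \<Longrightarrow> \<omega> \<in> space P \<Longrightarrow> Y \<theta> (int k - 1) \<omega> = F (\<lambda>\<eta>. Z (\<theta> @ \<eta>) \<omega>)"
    using Y_functional[of k] by blast
  then show ?thesis
    by (intro bexI[of _ "\<lambda>z. F z - y"]) (simp_all add: F)
qed

lemma measurable_Y: "\<theta> \<in> Theta \<Longrightarrow> Y \<theta> (int k - 1) \<in> borel_measurable P"
proof -
  assume \<theta>: "\<theta> \<in> Theta"
  obtain F where F: "F \<in> borel_measurable (\<Pi>\<^sub>M \<eta>\<in>UNIV. Zs)"
    "\<And>\<theta> \<omega>. \<theta> \<in> Theta \<Longrightarrow> \<omega> \<in> space P \<Longrightarrow> Y \<theta> (int k - 1) \<omega> = F (\<lambda>\<eta>. Z (\<theta> @ \<eta>) \<omega>)"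
    using Y_functional[of k] by blast
  have "range (\<lambda>\<eta>. \<theta> @ \<eta>) \<subseteq> Theta"
    using \<theta> by (auto simp: append_in_Theta)
  from measurable_compose[OF measurable_Z_reindex[OF this] F(1)] show ?thesis
    by (rule measurable_cong[THEN iffD1, rotated]) (simp add: F(2)[OF \<theta>])
qed

lemma measurable_sample:
  assumes "p \<in> Theta" "q \<in> Theta"
  shows "sample l p q \<in> borel_measurable P"
  unfolding sample_def[abs_def]
  using measurable_Y[OF assms(1), of "Suc l"] measurable_Y[OF assms(2), of l] Z_measurable[OF assms(1)]
  by simp

text \<open>For a frozen operator only the law of \<open>Y\<close> matters, and that is the same for
  every \<open>\<theta>\<close>. The hypotheses couple \<open>Y [0]\<close> with
  \<open>Y [1]\<close>; this lets the recursion close in terms of \<open>Y [0]\<close>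
  alone.\<close>

lemma second_moment_Y_index:
  fixes \<psi> :: "'w \<Rightarrow> 'y \<Rightarrow>\<^sub>L 'h :: {real_inner, banach, second_countable_topology}"
  assumes \<psi>: "\<psi> \<in> measurable P strong_algebra"
    and indep: "indep_set (generated_events P Theta Zs Z) {\<psi> -` A \<inter> space P | A. A \<in> sets strong_algebra}"
    and \<theta>: "\<theta> \<in> Theta"
  shows "second_moment P (\<lambda>\<omega>. blinfun_apply (\<psi> \<omega>) (Y \<theta> (int k - 1) \<omega> - y)) =
         second_moment P (\<lambda>\<omega>. blinfun_apply (\<psi> \<omega>) (Y [0] (int k - 1) \<omega> - y))"
proof -
  obtain F where F: "F \<in> borel_measurable (\<Pi>\<^sub>M \<eta>\<in>UNIV. Zs)"
    "\<And>\<theta> \<omega>. \<theta> \<in> Theta \<Longrightarrow> \<omega> \<in> space P \<Longrightarrow> Y \<theta> (int k - 1) \<omega> - y = F (\<lambda>\<eta>. Z (\<theta> @ \<eta>) \<omega>)"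
    using Y_minus_functional[of k y] by blast
  have Theta0: "[0] \<in> Theta"
    by (simp add: Theta_def)
  have range: "range (\<lambda>\<eta>. \<theta> @ \<eta>) \<subseteq> Theta" if "\<theta> \<in> Theta" for \<theta>
    using that by (auto simp: append_in_Theta)
  note sm = second_moment_functional[OF \<psi> indep range F(1) F(2)]
  have law: "distr P borel (\<lambda>\<omega>. Y \<theta> (int k - 1) \<omega> - y)
      = distr (\<Pi>\<^sub>M u\<in>UNIV. distr P Zs (Z [0])) borel F" if "\<theta> \<in> Theta" for \<theta>
    using that by (intro functional_law[of "\<lambda>\<eta>. \<theta> @ \<eta>"] F range) (auto simp: inj_def)
  have "second_moment P (\<lambda>\<omega>. blinfun_apply \<phi> (Y \<theta> (int k - 1) \<omega> - y)) =
      second_moment P (\<lambda>\<omega>. blinfun_apply \<phi> (Y [0] (int k - 1) \<omega> - y))" for \<phi> :: "'y \<Rightarrow>\<^sub>L 'h"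
    using second_moment_eq_distr[OF sm(1)[OF \<theta> \<theta>], of \<phi>] second_moment_eq_distr[OF sm(1)[OF Theta0 Theta0], of \<phi>]
    by (simp only: law[OF \<theta>] law[OF Theta0])
  then show ?thesis
    using sm(2)[OF \<theta> \<theta>] sm(2)[OF Theta0 Theta0] by simp
qed

text \<open>Bias plus variance. The hypotheses about samples concern only the indices
  \<open>[0]\<close> and \<open>[1]\<close>, so every summand of the scheme is first replaced by
  that one with the same law.\<close>

lemma second_moment_Y_error:
  fixes \<psi> :: "'w \<Rightarrow> 'y \<Rightarrow>\<^sub>L 'h :: {real_inner, banach, second_countable_topology}"
  assumes \<psi>: "\<psi> \<in> measurable P strong_algebra"
    and indep: "indep_set (generated_events P Theta Zs Z) {\<psi> -` A \<inter> space P | A. A \<in> sets strong_algebra}"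
    and integrable: "\<And>l. integrable P (sample l [0] [1])"
    and n: "1 \<le> n"
  shows "second_moment P (\<lambda>\<omega>. blinfun_apply (\<psi> \<omega>) (Y [0] (int n) \<omega> - y))
     \<le> second_moment P (\<lambda>\<omega>. blinfun_apply (\<psi> \<omega>) (y - (\<Sum>l = 0..<n. expectation (sample l [0] [1]))))
       + (\<Sum>l = 0..<n. ennreal (1 / real m ^ (n - l)) *
            second_moment P (\<lambda>\<omega>. blinfun_apply (\<psi> \<omega>) (sample l [0] [1] \<omega>)))"
proof -
  define I where "I = (SIGMA l : {0..<n}. {1..m ^ (n - l)})"
  define p where "p x = [0, int (fst x), int (snd x)]" for x :: "nat \<times> nat"
  \<comment> \<open>For \<open>l = 0\<close> the indices \<open>(\<theta>, l, i)\<close> and \<open>(\<theta>, -l, i)\<close> coincide; as \<open>Y\<^sub>-\<^sub>1\<close> is constant, the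
    second one may be replaced by an index that occurs nowhere else.\<close>
  define q where "q x = (if fst x = 0 then [0, 0, - int (snd x)] else [0, - int (fst x), int (snd x)])" for x :: "nat \<times> nat"
  define X where "X x = sample (fst x) (p x) (q x)" for x
  define a where "a x = 1 / real m ^ (n - fst x)" for x :: "nat \<times> nat"
  have I: "finite I" and I_pos: "\<And>x. x \<in> I \<Longrightarrow> 1 \<le> snd x"
    by (auto simp: I_def)
  have Theta: "[0] \<in> Theta" "[1] \<in> Theta" "p x \<in> Theta" "q x \<in> Theta" for x
    by (simp_all add: Theta_def p_def q_def)
  have len: "length (p x) = 3" "length (q x) = 3" for x
    by (simp_all add: p_def q_def)
  have pq: "p x \<noteq> q x" if "x \<in> I" for x
    using I_pos[OF that] by (auto simp: p_def q_def)
  have law: "distr P borel (X x) = distr P borel (sample (fst x) [0] [1])" if "x \<in> I" for x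
    unfolding X_def using len by (intro sample_law Theta pq that) simp
  have X_meas: "X x \<in> borel_measurable P" for x
    unfolding X_def by (intro measurable_sample Theta)
  have s_meas: "sample l [0] [1] \<in> borel_measurable P" for l
    by (intro measurable_sample Theta)
  have X_int: "integrable P (X x)" if "x \<in> I" for x
    using integrable_distr_eq[OF X_meas, of "\<lambda>v. v" x] integrable_distr_eq[OF s_meas, of "\<lambda>v. v" "fst x"]
      integrable law[OF that] by simp
  have X_mean: "expectation (X x) = expectation (sample (fst x) [0] [1])" if "x \<in> I" for x
    using integral_distr[OF X_meas, of "\<lambda>v. v" x] integral_distr[OF s_meas, of "\<lambda>v. v" "fst x"]
      law[OF that] by simp
  have X_sm: "second_moment P (\<lambda>\<omega>. blinfun_apply \<phi> (X x \<omega>)) =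
      second_moment P (\<lambda>\<omega>. blinfun_apply \<phi> (sample (fst x) [0] [1] \<omega>))" if "x \<in> I" for x and \<phi> :: "'y \<Rightarrow>\<^sub>L 'h"
    using second_moment_eq_distr[OF X_meas, of \<phi> x] second_moment_eq_distr[OF s_meas, of \<phi> "fst x"]
      law[OF that] by simp
  have X_indep: "indep_var borel (X x) borel (X x')" if "x \<in> I" "x' \<in> I" "x \<noteq> x'" for x x'
  proof -
    \<comment> \<open>For positive \<open>l\<close> the sign of the middle entry separates the two
      kinds of index; for \<open>l = 0\<close> the sign of the last entry does, since
      \<open>i\<close> starts at 1.\<close>
    have "{p x, q x} \<inter> {p x', q x'} = {}"
      using I_pos[OF that(1)] I_pos[OF that(2)] that(3)
      by (cases x; cases x') (auto simp: p_def q_def split: if_splits)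
    then show ?thesis
      unfolding X_def using len by (intro sample_indep Theta) simp_all
  qed
  have I_sum: "(\<Sum>x\<in>I. f x) = (\<Sum>l = 0..<n. \<Sum>i = 1..m ^ (n - l). f (l, i))"
    for f :: "nat \<times> nat \<Rightarrow> 'b :: comm_monoid_add"
    unfolding I_def by (subst sum.Sigma) auto
  have Y_eq: "Y [0] (int n) \<omega> = (\<Sum>x\<in>I. a x *\<^sub>R X x \<omega>)" if "\<omega> \<in> space P" for \<omega>
  proof -
    have "\<Phi> l (Y ([0] @ [int l, int i]) (int l) \<omega>, Y ([0] @ [- int l, int i]) (int l - 1) \<omega>,
        Z ([0] @ [int l, int i]) \<omega>) = X (l, i) \<omega>" for l i
      using that by (auto simp: X_def p_def q_def sample_def Y_minus_one Theta_def)
    then show ?thesis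
      using Y_pos[OF Theta(1) n that] by (simp add: I_sum a_def scaleR_sum_right)
  qed
  have m: "real m > 0"
    using m_pos by simp
  have mean: "(\<Sum>x\<in>I. a x *\<^sub>R expectation (X x)) = (\<Sum>l = 0..<n. expectation (sample l [0] [1]))"
  proof -
    have "(\<Sum>x\<in>I. a x *\<^sub>R expectation (X x)) = (\<Sum>x\<in>I. a x *\<^sub>R expectation (sample (fst x) [0] [1]))"
      by (intro sum.cong) (simp_all add: X_mean)
    also have "\<dots> = (\<Sum>l = 0..<n. expectation (sample l [0] [1]))"
      unfolding I_sum using m by (intro sum.cong) (simp_all add: a_def sum_constant_scaleR)
    finally show ?thesis .
  qed
  have variance: "(\<Sum>x\<in>I. ennreal ((a x)\<^sup>2) * f (fst x)) = (\<Sum>l = 0..<n. ennreal (1 / real m ^ (n - l)) * f l)"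
    for f :: "nat \<Rightarrow> ennreal"
    unfolding I_sum
  proof (intro sum.cong refl)
    fix l
    have "(\<Sum>i = 1..m ^ (n - l). ennreal ((a (l, i))\<^sup>2) * f (fst (l, i)))
        = ennreal (real (m ^ (n - l)) * (1 / real m ^ (n - l))\<^sup>2) * f l"
      by (simp add: a_def ennreal_mult ennreal_of_nat_eq_real_of_nat mult.assoc)
    \<comment> \<open>The Monte Carlo gain: averaging over \<open>m ^ (n - l)\<close> copies divides
      the second moment by their number.\<close>
    also have "real (m ^ (n - l)) * (1 / real m ^ (n - l))\<^sup>2 = 1 / real m ^ (n - l)"
      using m by (simp add: power2_eq_square)
    finally show "(\<Sum>i = 1..m ^ (n - l). ennreal ((a (l, i))\<^sup>2) * f (fst (l, i)))
        = ennreal (1 / real m ^ (n - l)) * f l" .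
  qed
  have fixed: "second_moment P (\<lambda>\<omega>. blinfun_apply \<phi> (Y [0] (int n) \<omega> - y))
     \<le> ennreal ((norm (blinfun_apply \<phi> (y - (\<Sum>l = 0..<n. expectation (sample l [0] [1])))))\<^sup>2)
       + (\<Sum>l = 0..<n. ennreal (1 / real m ^ (n - l)) *
            second_moment P (\<lambda>\<omega>. blinfun_apply \<phi> (sample l [0] [1] \<omega>)))" for \<phi> :: "'y \<Rightarrow>\<^sub>L 'h"
  proof -
    have "second_moment P (\<lambda>\<omega>. blinfun_apply \<phi> (Y [0] (int n) \<omega> - y)) =
        second_moment P (\<lambda>\<omega>. blinfun_apply \<phi> ((\<Sum>x\<in>I. a x *\<^sub>R X x \<omega>) - y))"
      by (intro nn_integral_cong) (simp add: Y_eq)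
    also have "\<dots> \<le> ennreal ((norm (blinfun_apply \<phi> (y - (\<Sum>x\<in>I. a x *\<^sub>R expectation (X x)))))\<^sup>2)
       + (\<Sum>x\<in>I. ennreal ((a x)\<^sup>2) * second_moment P (\<lambda>\<omega>. blinfun_apply \<phi> (X x \<omega>)))"
      using m by (intro second_moment_blinfun_sum_pairwise_indep I X_int X_indep) (auto simp: a_def)
    also have "(\<Sum>x\<in>I. ennreal ((a x)\<^sup>2) * second_moment P (\<lambda>\<omega>. blinfun_apply \<phi> (X x \<omega>))) =
        (\<Sum>x\<in>I. ennreal ((a x)\<^sup>2) * second_moment P (\<lambda>\<omega>. blinfun_apply \<phi> (sample (fst x) [0] [1] \<omega>)))"
      by (intro sum.cong) (simp_all add: X_sm)
    finally show ?thesis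
      unfolding mean variance[of "\<lambda>l. second_moment P (\<lambda>\<omega>. blinfun_apply \<phi> (sample l [0] [1] \<omega>))"] .
  qed
  obtain F where F: "F \<in> borel_measurable (\<Pi>\<^sub>M \<eta>\<in>UNIV. Zs)"
    "\<And>\<theta> \<omega>. \<theta> \<in> Theta \<Longrightarrow> \<omega> \<in> space P \<Longrightarrow> Y \<theta> (int (Suc n) - 1) \<omega> - y = F (\<lambda>\<eta>. Z (\<theta> @ \<eta>) \<omega>)"
    using Y_minus_functional[of "Suc n" y] by blast
  have F': "\<omega> \<in> space P \<Longrightarrow> Y [0] (int n) \<omega> - y = F (\<lambda>\<eta>. Z ([0] @ \<eta>) \<omega>)" for \<omega>
    using F(2)[OF Theta(1), of \<omega>] by simp
  have range0: "range (\<lambda>\<eta>. [0] @ \<eta>) \<subseteq> Theta"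
    by (auto simp: Theta_def)
  have range01: "range (paired_index [0] [1]) \<subseteq> Theta"
    by (auto simp: Theta_def paired_index_def split: if_splits)
  have smp: "second_moment P (\<lambda>\<omega>. blinfun_apply (\<psi> \<omega>) (sample l [0] [1] \<omega>)) =
     (\<integral>\<^sup>+ \<phi>. second_moment P (\<lambda>\<omega>. blinfun_apply \<phi> (sample l [0] [1] \<omega>)) \<partial>distr P strong_algebra \<psi>)"
    "(\<lambda>\<phi> :: 'y \<Rightarrow>\<^sub>L 'h. second_moment P (\<lambda>\<omega>. blinfun_apply \<phi> (sample l [0] [1] \<omega>))) \<in> borel_measurable strong_algebra"
    for l
  proof -
    obtain K where K: "K \<in> borel_measurable (\<Pi>\<^sub>M \<eta>\<in>UNIV. Zs)"
      "\<And>p q \<omega>. p \<in> Theta \<Longrightarrow> q \<in> Theta \<Longrightarrow> \<omega> \<in> space P \<Longrightarrow> sample l p q \<omega> = K (\<lambda>u. Z (paired_index p q u) \<omega>)"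
      using sample_functional[of l] by blast
    show "second_moment P (\<lambda>\<omega>. blinfun_apply (\<psi> \<omega>) (sample l [0] [1] \<omega>)) =
     (\<integral>\<^sup>+ \<phi>. second_moment P (\<lambda>\<omega>. blinfun_apply \<phi> (sample l [0] [1] \<omega>)) \<partial>distr P strong_algebra \<psi>)"
      "(\<lambda>\<phi> :: 'y \<Rightarrow>\<^sub>L 'h. second_moment P (\<lambda>\<omega>. blinfun_apply \<phi> (sample l [0] [1] \<omega>))) \<in> borel_measurable strong_algebra"
      using second_moment_functional(2,3)[OF \<psi> indep range01 K(1) K(2)[OF Theta(1,2)]] by blast+
  qed
  let ?d = "y - (\<Sum>l = 0..<n. expectation (sample l [0] [1]))"
  have eval: "(\<lambda>\<phi>. blinfun_apply \<phi> ?d) \<in> borel_measurable (strong_algebra :: ('y \<Rightarrow>\<^sub>L 'h) measure)"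
    by (rule borel_measurable_blinfun_apply_strong) simp_all
  note [measurable] = eval smp(2) \<psi>
  \<comment> \<open>The estimate \<open>fixed\<close> holds for every operator, also where a side is
    infinite, so it can be integrated over the law of \<open>\<psi>\<close> without exceptional
    sets.\<close>
  have "second_moment P (\<lambda>\<omega>. blinfun_apply (\<psi> \<omega>) (Y [0] (int n) \<omega> - y)) =
      (\<integral>\<^sup>+ \<phi>. second_moment P (\<lambda>\<omega>. blinfun_apply \<phi> (Y [0] (int n) \<omega> - y)) \<partial>distr P strong_algebra \<psi>)"
    by (rule second_moment_functional(2)[OF \<psi> indep range0 F(1) F'])
  also have "\<dots> \<le> (\<integral>\<^sup>+ \<phi>. ennreal ((norm (blinfun_apply \<phi> ?d))\<^sup>2)
       + (\<Sum>l = 0..<n. ennreal (1 / real m ^ (n - l)) *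
            second_moment P (\<lambda>\<omega>. blinfun_apply \<phi> (sample l [0] [1] \<omega>))) \<partial>distr P strong_algebra \<psi>)"
    by (intro nn_integral_mono fixed)
  also have "\<dots> = (\<integral>\<^sup>+ \<phi>. ennreal ((norm (blinfun_apply \<phi> ?d))\<^sup>2) \<partial>distr P strong_algebra \<psi>)
       + (\<Sum>l = 0..<n. ennreal (1 / real m ^ (n - l)) *
            (\<integral>\<^sup>+ \<phi>. second_moment P (\<lambda>\<omega>. blinfun_apply \<phi> (sample l [0] [1] \<omega>)) \<partial>distr P strong_algebra \<psi>))"
    by (subst nn_integral_add, measurable, subst nn_integral_sum, measurable)
      (simp add: nn_integral_cmult)
  also have "(\<integral>\<^sup>+ \<phi>. ennreal ((norm (blinfun_apply \<phi> ?d))\<^sup>2) \<partial>distr P strong_algebra \<psi>)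
      = second_moment P (\<lambda>\<omega>. blinfun_apply (\<psi> \<omega>) ?d)"
    by (subst nn_integral_distr) simp_all
  finally show ?thesis
    unfolding smp(1) .
qed

end

subsection \<open>Error and cost recursions\<close>

lemma ennsqrt_le:
  assumes "x \<le> ennreal (r\<^sup>2)" "0 \<le> r"
  shows "ennsqrt x \<le> ennreal r"
proof -
  have "x \<noteq> \<infinity>"
    using assms(1) by (auto simp: top_unique)
  moreover have "enn2real x \<le> r\<^sup>2"
    using assms(1) by (metis enn2real_ennreal enn2real_mono ennreal_less_top zero_le_power2)
  ultimately show ?thesis
    using assms(2) by (simp add: ennsqrt_def ennreal_leI real_le_lsqrt)
qed

text \<open>For positive \<open>n\<close> and \<open>q = 1 + 4 * c\<close>, each power of
  \<open>q\<close> from 1 to \<open>n\<close> has total coefficient \<open>4 * c = q - 1\<close>,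
  the top one thanks to the separate term. The power 0 gets only \<open>2 * c\<close>, which is the
  defect on the right; the rest is a geometric sum.\<close>

lemma error_recursion_power_identity:
  fixes c :: real
  shows "1 + 2 * c * (1 + 4 * c) ^ n + (\<Sum>l = 1..<Suc n. 2 * c * ((1 + 4 * c) ^ l + (1 + 4 * c) ^ (l - 1)))
    = (1 + 4 * c) ^ Suc n - 2 * c"
  by (induction n) (simp_all add: algebra_simps)

text \<open>Each unfolding raises \<open>k\<close> by one and lowers \<open>n\<close> by at least
  one, so the induction runs over \<open>n\<close> for all \<open>k\<close> simultaneously and stays
  inside \<open>k + n \<le> N\<close>. The corner \<open>k = n = 0\<close> is excluded because level
  0 is controlled only for positive \<open>k\<close>.\<close>

lemma error_recursion_bound:
  fixes e :: "nat \<Rightarrow> nat \<Rightarrow> ennreal" and m c K :: real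
  assumes m: "1 \<le> m" and c: "0 \<le> c" and K: "0 \<le> K"
    and base: "\<And>k. 1 \<le> k \<Longrightarrow> k \<le> N \<Longrightarrow> e k 0 \<le> ennreal (K / m ^ k)"
    and rec: "\<And>k n. 1 \<le> n \<Longrightarrow> k + n \<le> N \<Longrightarrow>
      e k n \<le> ennreal (K / m ^ (k + n)) + ennreal (2 * c) * e (k + 1) (n - 1)
        + (\<Sum>l = 1..<n. ennreal (1 / m ^ (n - l)) * (ennreal (2 * c) * (e (k + 1) l + e (k + 1) (l - 1))))"
    and "1 \<le> k + n" "k + n \<le> N"
  shows "e k n \<le> ennreal (K / m ^ (k + n) * (1 + 4 * c) ^ n)"
  using assms(6,7)
proof (induction n arbitrary: k rule: less_induct)
  case (less n)
  show ?case
  proof (cases n)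
    case 0
    then show ?thesis
      using less.prems base[of k] by simp
  next
    case (Suc n')
    define Q where "Q = K / m ^ (k + n)"
    define q where "q = 1 + 4 * c"
    have pos: "0 \<le> Q" "0 < m" "1 \<le> q"
      using m c K by (auto simp: Q_def q_def)
    have mult: "ennreal (u * (v * w)) = ennreal u * (ennreal v * ennreal w)"
      if "0 \<le> u" "0 \<le> v" "0 \<le> w" for u v w
      using that by (simp add: ennreal_mult)
    have IH: "e (k + 1) l \<le> ennreal (K / m ^ (k + 1 + l) * q ^ l)" if "l < n" for l
      using less.IH[OF that, of "k + 1"] less.prems that by (simp add: q_def)
    have "e (k + 1) (n - 1) \<le> ennreal (Q * q ^ n')"
      using IH[of "n - 1"] Suc by (simp add: Q_def)
    then have t1: "ennreal (2 * c) * e (k + 1) (n - 1) \<le> ennreal (2 * c * (Q * q ^ n'))"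
      using pos c by (subst ennreal_mult) (auto intro!: mult_left_mono)
    have t2: "ennreal (1 / m ^ (n - l)) * (ennreal (2 * c) * (e (k + 1) l + e (k + 1) (l - 1)))
        \<le> ennreal (Q * (2 * c * (q ^ l + q ^ (l - 1))))" if l: "l \<in> {1..<n}" for l
    proof -
      have "e (k + 1) l + e (k + 1) (l - 1)
          \<le> ennreal (K / m ^ (k + 1 + l) * q ^ l) + ennreal (K / m ^ (k + 1 + (l - 1)) * q ^ (l - 1))"
        using l by (intro add_mono IH) auto
      also have "\<dots> = ennreal (K / m ^ (k + 1 + l) * q ^ l + K / m ^ (k + 1 + (l - 1)) * q ^ (l - 1))"
        using pos K by (intro ennreal_plus[symmetric]) auto
      \<comment> \<open>Level \<open>l\<close> carries one more power of \<open>m\<close> in the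
        denominator than level \<open>l - 1\<close>. It is given up, so that both combine with the
        weight \<open>1 / m ^ (n - l)\<close> to \<open>1 / m ^ (k + n)\<close>.\<close>
      also have "\<dots> \<le> ennreal (K / m ^ (k + l) * (q ^ l + q ^ (l - 1)))"
      proof (rule ennreal_leI)
        have "K / m ^ (k + 1 + l) * q ^ l \<le> K / m ^ (k + l) * q ^ l"
          using pos K m by (intro mult_right_mono divide_left_mono power_increasing) auto
        moreover have "k + 1 + (l - 1) = k + l"
          using l by simp
        ultimately show "K / m ^ (k + 1 + l) * q ^ l + K / m ^ (k + 1 + (l - 1)) * q ^ (l - 1)
            \<le> K / m ^ (k + l) * (q ^ l + q ^ (l - 1))"
          by (simp only: distrib_left)
      qed
      finally have "ennreal (1 / m ^ (n - l)) * (ennreal (2 * c) * (e (k + 1) l + e (k + 1) (l - 1)))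
          \<le> ennreal (1 / m ^ (n - l)) * (ennreal (2 * c) * ennreal (K / m ^ (k + l) * (q ^ l + q ^ (l - 1))))"
        by (intro mult_left_mono) auto
      also have "\<dots> = ennreal (1 / m ^ (n - l) * (2 * c * (K / m ^ (k + l) * (q ^ l + q ^ (l - 1)))))"
        using pos K c by (intro mult[symmetric]) auto
      also have "1 / m ^ (n - l) * (2 * c * (K / m ^ (k + l) * (q ^ l + q ^ (l - 1))))
          = Q * (2 * c * (q ^ l + q ^ (l - 1)))"
        using l by (simp add: Q_def power_add[symmetric] add.commute mult_ac)
      finally show ?thesis .
    qed
    have "e k n \<le> ennreal Q + ennreal (2 * c) * e (k + 1) (n - 1)
        + (\<Sum>l = 1..<n. ennreal (1 / m ^ (n - l)) * (ennreal (2 * c) * (e (k + 1) l + e (k + 1) (l - 1))))"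
      unfolding Q_def using Suc less.prems by (intro rec) auto
    also have "\<dots> \<le> ennreal Q + ennreal (2 * c * (Q * q ^ n'))
        + (\<Sum>l = 1..<n. ennreal (Q * (2 * c * (q ^ l + q ^ (l - 1)))))"
      by (intro add_mono t1 sum_mono t2 order_refl)
    also have "\<dots> = ennreal (Q + 2 * c * (Q * q ^ n') + (\<Sum>l = 1..<n. Q * (2 * c * (q ^ l + q ^ (l - 1)))))"
      using pos c by (simp add: sum_nonneg)
    also have "Q + 2 * c * (Q * q ^ n') + (\<Sum>l = 1..<n. Q * (2 * c * (q ^ l + q ^ (l - 1))))
        = Q * (1 + 2 * c * q ^ n' + (\<Sum>l = 1..<n. 2 * c * (q ^ l + q ^ (l - 1))))"
      by (simp add: algebra_simps sum_distrib_left)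
    also have "\<dots> = Q * (q ^ n - 2 * c)"
      using error_recursion_power_identity[of c n'] by (simp only: Suc q_def)
    also have "ennreal (Q * (q ^ n - 2 * c)) \<le> ennreal (Q * q ^ n)"
      using pos c by (intro ennreal_leI mult_left_mono) auto
    finally show ?thesis
      by (simp add: Q_def q_def)
  qed
qed

text \<open>Divided by \<open>m ^ n * z\<close>, level \<open>l\<close> contributes two earlier
  costs and one overhead \<open>\<gamma>\<close>, in total \<open>2 + \<gamma>\<close> times the
  bound for \<open>l\<close>. The ratio \<open>q = 3 + \<gamma>\<close> is chosen with
  \<open>q - 1 = 2 + \<gamma>\<close>, so that the geometric sum closes exactly.\<close>

lemma cost_recursion_bound:
  fixes cost :: "int \<Rightarrow> real" and m z \<gamma> :: real
  assumes m: "1 \<le> m" and z: "0 \<le> z" and \<gamma>: "0 \<le> \<gamma>"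
    and init: "cost (-1) = 0" "cost 0 = 0"
    and rec: "\<And>n. 1 \<le> n \<Longrightarrow> cost (int n) \<le> m ^ n * z +
             (\<Sum>l = 0..<n. m ^ (n - l) * (cost (int l) + cost (int l - 1) + \<gamma> * z))"
  shows "cost (int n) \<le> (3 + \<gamma>) ^ n * m ^ n * z"
proof (induction n rule: less_induct)
  case (less n)
  define q where "q = 3 + \<gamma>"
  have q: "1 \<le> q"
    using \<gamma> by (simp add: q_def)
  show ?case
  proof (cases "n = 0")
    case True
    then show ?thesis
      using init z by simp
  next
    case False
    have bound: "m ^ (n - l) * (cost (int l) + cost (int l - 1) + \<gamma> * z) \<le> m ^ n * z * ((2 + \<gamma>) * q ^ l)"
      if "l < n" for l
    proof -
      have 1: "cost (int l) \<le> q ^ l * m ^ l * z"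
        using less.IH[OF that] by (simp add: q_def)
      have 2: "cost (int l - 1) \<le> q ^ l * m ^ l * z"
      proof (cases l)
        case 0
        then show ?thesis
          using init z by simp
      next
        case (Suc l')
        then have "cost (int l - 1) \<le> q ^ l' * m ^ l' * z"
          using less.IH[of l'] that by (simp add: q_def)
        also have "\<dots> \<le> q ^ l * m ^ l * z"
          using Suc m q z by (intro mult_right_mono mult_mono power_increasing) auto
        finally show ?thesis .
      qed
      have "1 \<le> q ^ l * m ^ l"
        using one_le_power[OF q, of l] one_le_power[OF m, of l] mult_mono[of 1 "q ^ l" 1 "m ^ l"] by simp
      \<comment> \<open>The constant overhead is enlarged to the size of the two cost bounds, so
        that all three share the factor \<open>q ^ l * m ^ l * z\<close>.\<close>
      then have 3: "\<gamma> * z \<le> \<gamma> * (q ^ l * m ^ l * z)"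
        using z \<gamma> mult_right_mono[of 1 "q ^ l * m ^ l" z] by (intro mult_left_mono) auto
      have "m ^ (n - l) * (cost (int l) + cost (int l - 1) + \<gamma> * z)
          \<le> m ^ (n - l) * (q ^ l * m ^ l * z + q ^ l * m ^ l * z + \<gamma> * (q ^ l * m ^ l * z))"
        using add_mono[OF add_mono[OF 1 2] 3] m by (intro mult_left_mono) auto
      also have "\<dots> = (m ^ (n - l) * m ^ l) * z * ((2 + \<gamma>) * q ^ l)"
        by (simp add: algebra_simps)
      also have "m ^ (n - l) * m ^ l = m ^ n"
        using that by (simp add: power_add[symmetric])
      finally show ?thesis .
    qed
    have geometric: "1 + (\<Sum>l = 0..<k. (2 + \<gamma>) * q ^ l) = q ^ k" for k
      by (induction k) (simp_all add: q_def algebra_simps)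
    have "cost (int n) \<le> m ^ n * z + (\<Sum>l = 0..<n. m ^ (n - l) * (cost (int l) + cost (int l - 1) + \<gamma> * z))"
      using False by (intro rec) simp
    also have "\<dots> \<le> m ^ n * z + (\<Sum>l = 0..<n. m ^ n * z * ((2 + \<gamma>) * q ^ l))"
      by (intro add_left_mono sum_mono bound) simp
    also have "\<dots> = m ^ n * z * (1 + (\<Sum>l = 0..<n. (2 + \<gamma>) * q ^ l))"
      by (simp add: sum_distrib_left distrib_left)
    also have "\<dots> = (3 + \<gamma>) ^ n * m ^ n * z"
      by (simp add: geometric, simp add: q_def)
    finally show ?thesis .
  qed
qed

section \<open>Growth of the sample counts and cost at the threshold\<close>

lemma powr_threshold_sequence_bounded:
  fixes M :: "nat \<Rightarrow> nat" and \<delta> A :: real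
  assumes "filterlim M at_top sequentially" and \<delta>: "0 < \<delta>" and A: "0 \<le> A"
  obtains B where "\<And>n. (A / real (M n) powr \<delta>) ^ n \<le> B"
proof -
  have "filterlim (\<lambda>n. real (M n)) at_top sequentially"
    using filterlim_compose[OF filterlim_real_sequentially assms(1)] .
  then have "eventually (\<lambda>n. real (M n) \<ge> max 1 (A powr (1 / \<delta>))) sequentially"
    by (rule filterlim_at_top[THEN iffD1, rule_format])
  then obtain N where N: "\<And>n. n \<ge> N \<Longrightarrow> real (M n) \<ge> max 1 (A powr (1 / \<delta>))"
    by (auto simp: eventually_sequentially)
  define t where "t n = (A / real (M n) powr \<delta>) ^ n" for n
  have t_nonneg: "0 \<le> t n" for n
    using A by (simp add: t_def)
  \<comment> \<open>From \<open>N\<close> on the base is at most 1, so the powers are too. The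
    finitely many earlier terms are covered by their sum, as all are nonnegative.\<close>
  have "t n \<le> 1 + sum t {..<N}" for n
  proof (cases "n < N")
    case True
    then have "t n \<le> sum t {..<N}"
      using t_nonneg by (intro member_le_sum) auto
    then show ?thesis by simp
  next
    case False
    then have M: "1 \<le> real (M n)" "A powr (1 / \<delta>) \<le> real (M n)"
      using N[of n] by auto
    have "A = (A powr (1 / \<delta>)) powr \<delta>"
      using A \<delta> by (cases "A = 0") (simp_all add: powr_powr)
    also have "\<dots> \<le> real (M n) powr \<delta>"
      using M \<delta> by (intro powr_mono2) auto
    finally have "A / real (M n) powr \<delta> \<le> 1"
      using M by (simp add: divide_le_eq_1)
    then have "t n \<le> 1"
      unfolding t_def using A by (intro power_le_one) auto
    then show ?thesis
      using t_nonneg by (simp add: sum_nonneg add_increasing2)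
  qed
  then show ?thesis
    by (intro that[of "1 + sum t {..<N}"]) (simp add: t_def)
qed

text \<open>Once \<open>M n \<ge> 4 * a\<close> the base is at most 1/4, and its power
  \<open>n / 2\<close> is at most \<open>2^(-n)\<close>.\<close>

lemma eventually_powr_error_le:
  fixes M :: "nat \<Rightarrow> nat" and a C \<epsilon> :: real
  assumes "filterlim M at_top sequentially" and "0 \<le> a" "0 \<le> C" "0 < \<epsilon>"
  shows "eventually (\<lambda>n. C * (a / real (M n)) powr (real n / 2) \<le> \<epsilon>) sequentially"
proof -
  have "filterlim (\<lambda>n. real (M n)) at_top sequentially"
    using filterlim_compose[OF filterlim_real_sequentially assms(1)] .
  then have "eventually (\<lambda>n. real (M n) \<ge> max 1 (4 * a)) sequentially"
    by (rule filterlim_at_top[THEN iffD1, rule_format])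
  moreover have "(\<lambda>n. C * (1 / 2) ^ n) \<longlonglongrightarrow> C * 0"
    by (intro tendsto_intros LIMSEQ_power_zero) simp
  then have "eventually (\<lambda>n. C * (1 / 2) ^ n < \<epsilon>) sequentially"
    using assms(4) by (auto dest: order_tendstoD)
  ultimately show ?thesis
  proof eventually_elim
    case (elim n)
    then have "a / real (M n) \<le> 1 / 4"
      by (simp add: field_simps)
    then have "(a / real (M n)) powr (real n / 2) \<le> (1 / 4) powr (real n / 2)"
      using assms(2) by (intro powr_mono2) auto
    also have "(1 / 4 :: real) = (1 / 2) powr 2"
      by (simp add: power2_eq_square)
    also have "((1 / 2 :: real) powr 2) powr (real n / 2) = (1 / 2) ^ n"
      by (simp only: powr_powr) (simp add: powr_realpow)
    finally have "C * (a / real (M n)) powr (real n / 2) \<le> C * (1 / 2) ^ n"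
      using assms(3) by (intro mult_left_mono)
    with elim show ?case by simp
  qed
qed

text \<open>Meant for \<open>m = M n\<close> and \<open>m' = M (n + 1)\<close>, where
  \<open>n + 1\<close> is the threshold. Of the \<open>n + 1\<close> factors \<open>m'\<close>, one
  is bounded by \<open>c1 * b ^ Suc n\<close>, so that no power of \<open>m\<close> is left over,
  and the others by \<open>B * m\<close>. The result is multiplied by the power
  \<open>2 * (1 + \<delta>)\<close> of \<open>C * (a / m) powr (n / 2) / \<epsilon>\<close>, which
  is at least 1.\<close>

lemma cost_at_threshold_le:
  fixes a b B q C \<epsilon> \<delta> z c1 m m' :: real
  assumes "1 \<le> a" "1 \<le> b" "1 \<le> B" "1 \<le> q" "1 \<le> C" "0 < \<epsilon>" "0 < \<delta>" "0 \<le> z" "0 < c1" "1 \<le> m" "0 \<le> m'"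
    and above: "\<epsilon> \<le> C * (a / m) powr (real n / 2)"
    and m'_ratio: "m' \<le> B * m" and m'_le: "m' \<le> c1 * b ^ Suc n"
  shows "q ^ Suc n * m' ^ Suc n * z \<le>
     z * b * c1 * q * C powr (2 * (1 + \<delta>)) * ((q * B * b * a) powr (1 + \<delta>) / m powr \<delta>) ^ n
       * \<epsilon> powr (- 2 * (1 + \<delta>))"
proof -
  define g where "g = q * B * b"
  have "1 * 1 * 1 \<le> q * B * b"
    using assms by (intro mult_mono) auto
  then have g: "1 \<le> g"
    by (simp add: g_def)
  have expand: "(C * X / \<epsilon>) powr p = C powr p * X powr p * \<epsilon> powr (- p)" if "0 \<le> X" for X p
    using assms(5,6) that by (simp add: powr_mult powr_divide powr_minus_divide)
  have minus: "- 2 * (1 + \<delta>) = - (2 * (1 + \<delta>))"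
    by simp
  have "1 \<le> C * (a / m) powr (real n / 2) / \<epsilon>"
    using above assms(6) by simp
  then have "1 powr (2 * (1 + \<delta>)) \<le> (C * (a / m) powr (real n / 2) / \<epsilon>) powr (2 * (1 + \<delta>))"
    using assms by (intro powr_mono2) auto
  also have "\<dots> = C powr (2 * (1 + \<delta>)) * (a / m) powr (real n / 2 * (2 * (1 + \<delta>))) * \<epsilon> powr (- 2 * (1 + \<delta>))"
    unfolding minus by (subst expand) (simp_all only: powr_powr powr_ge_zero)
  also have "real n / 2 * (2 * (1 + \<delta>)) = (1 + \<delta>) * real n"
    by simp
  also have "(a / m) powr ((1 + \<delta>) * real n) = ((a / m) powr (1 + \<delta>)) ^ n"
    using assms by (subst powr_powr[symmetric], subst powr_realpow) auto
  finally have one: "1 \<le> C powr (2 * (1 + \<delta>)) * ((a / m) powr (1 + \<delta>)) ^ n * \<epsilon> powr (- 2 * (1 + \<delta>))"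
    by simp
  have "g * m * (a / m) powr (1 + \<delta>) = g * (a powr (1 + \<delta>) / m powr \<delta>)"
    using assms by (simp add: powr_divide powr_add)
  \<comment> \<open>The loss from \<open>g\<close> to its power \<open>1 + \<delta>\<close> puts all
    constants under one exponent.\<close>
  also have "\<dots> \<le> g powr (1 + \<delta>) * (a powr (1 + \<delta>) / m powr \<delta>)"
    using powr_mono[of 1 "1 + \<delta>" g] g assms(7) by (intro mult_right_mono) auto
  also have "\<dots> = (g * a) powr (1 + \<delta>) / m powr \<delta>"
    using g assms by (simp add: powr_mult)
  finally have "(g * m * (a / m) powr (1 + \<delta>)) ^ n \<le> ((g * a) powr (1 + \<delta>) / m powr \<delta>) ^ n"
    using g assms by (intro power_mono) auto
  then have main: "(g * m) ^ n * ((a / m) powr (1 + \<delta>)) ^ n \<le> ((g * a) powr (1 + \<delta>) / m powr \<delta>) ^ n"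
    by (simp only: power_mult_distrib)
  have "q ^ Suc n * m' ^ Suc n * z \<le> q ^ Suc n * ((B * m) ^ n * (c1 * b ^ Suc n)) * z"
    unfolding power_Suc2[of m'] using assms by (intro mult_right_mono mult_left_mono mult_mono power_mono) auto
  also have "\<dots> = z * b * c1 * q * (g * m) ^ n * 1"
    by (simp add: g_def power_mult_distrib mult_ac)
  also have "\<dots> \<le> z * b * c1 * q * (g * m) ^ n
      * (C powr (2 * (1 + \<delta>)) * ((a / m) powr (1 + \<delta>)) ^ n * \<epsilon> powr (- 2 * (1 + \<delta>)))"
    using assms g by (intro mult_left_mono one) auto
  also have "\<dots> = z * b * c1 * q * C powr (2 * (1 + \<delta>)) * ((g * m) ^ n * ((a / m) powr (1 + \<delta>)) ^ n)
      * \<epsilon> powr (- 2 * (1 + \<delta>))"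
    by (simp add: mult_ac)
  also have "\<dots> \<le> z * b * c1 * q * C powr (2 * (1 + \<delta>)) * ((g * a) powr (1 + \<delta>) / m powr \<delta>) ^ n
      * \<epsilon> powr (- 2 * (1 + \<delta>))"
    using assms by (intro mult_right_mono mult_left_mono main) auto
  finally show ?thesis
    by (simp add: g_def)
qed

section \<open>From the moment hypotheses to the error recursion\<close>

lemma norm_blinfun_diff_square_le:
  fixes \<phi> :: "'y::real_normed_vector \<Rightarrow>\<^sub>L 'h::real_inner"
  shows "(norm (\<phi> (u - v)))\<^sup>2 \<le> 2 * (norm (\<phi> (u - w)))\<^sup>2 + 2 * (norm (\<phi> (v - w)))\<^sup>2"
proof -
  define s t where "s = \<phi> (u - w)" and "t = \<phi> (v - w)"
  have diff: "\<phi> (u - v) = s - t"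
    by (simp add: s_def t_def blinfun.diff_right)
  \<comment> \<open>The parallelogram law, whose second term on the left is discarded.\<close>
  have "(norm (s - t))\<^sup>2 + (norm (s + t))\<^sup>2 = 2 * (norm s)\<^sup>2 + 2 * (norm t)\<^sup>2"
    by (simp add: power2_norm_eq_inner inner_diff_left inner_diff_right inner_add_left inner_add_right inner_commute)
  moreover have "0 \<le> (norm (s + t))\<^sup>2"
    by simp
  ultimately show ?thesis
    unfolding diff s_def[symmetric] t_def[symmetric] by linarith
qed

text \<open>The initial bounds are required only for \<open>k \<le> N\<close>, which is the range in
  which the condition on \<open>\<cc> k\<close> can provide the form \<open>K / m ^ k\<close> with
  \<open>K\<close> independent of \<open>k\<close>.\<close>

lemma (in multilevel_picard) second_moment_Y_error_bound:
  fixes \<psi> :: "nat \<Rightarrow> 'w \<Rightarrow> 'y \<Rightarrow>\<^sub>L 'h :: {real_inner, banach, second_countable_topology}"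
    and c K :: real
  assumes \<psi>: "\<And>k. \<psi> k \<in> measurable P strong_algebra"
    and indep: "indep_set (generated_events P Theta Zs Z) (generated_events P UNIV strong_algebra \<psi>)"
    and integrable: "\<And>l. integrable P (sample l [0] [1])"
    and c: "0 \<le> c" and K: "0 \<le> K"
    and sample_0: "\<And>k. k \<le> N \<Longrightarrow>
      second_moment P (\<lambda>\<omega>. blinfun_apply (\<psi> k \<omega>) (sample 0 [0] [1] \<omega>)) \<le> ennreal (K / real m ^ k)"
    and Y_0: "\<And>k. 1 \<le> k \<Longrightarrow> k \<le> N \<Longrightarrow>
      second_moment P (\<lambda>\<omega>. blinfun_apply (\<psi> k \<omega>) (y0 - y)) \<le> ennreal (K / real m ^ k)"
    and contract: "\<And>k l. 1 \<le> l \<Longrightarrow> second_moment P (\<lambda>\<omega>. blinfun_apply (\<psi> k \<omega>) (sample l [0] [1] \<omega>))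
      \<le> ennreal c * second_moment P (\<lambda>\<omega>. blinfun_apply (\<psi> (k + 1) \<omega>) (Y [0] (int l) \<omega> - Y [1] (int l - 1) \<omega>))"
    and bias: "\<And>k n. 1 \<le> n \<Longrightarrow>
      second_moment P (\<lambda>\<omega>. blinfun_apply (\<psi> k \<omega>) (y - (\<Sum>l = 0..<n. expectation (sample l [0] [1]))))
      \<le> ennreal (2 * c) * second_moment P (\<lambda>\<omega>. blinfun_apply (\<psi> (k + 1) \<omega>) (Y [0] (int n - 1) \<omega> - y))"
    and N: "1 \<le> N"
  shows "second_moment P (\<lambda>\<omega>. blinfun_apply (\<psi> 0 \<omega>) (Y [0] (int N) \<omega> - y))
    \<le> ennreal (K / real m ^ N * (1 + 4 * c) ^ N)"
proof -
  define e where "e k n = second_moment P (\<lambda>\<omega>. blinfun_apply (\<psi> k \<omega>) (Y [0] (int n) \<omega> - y))" for k n :: nat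
  define s where "s k l = second_moment P (\<lambda>\<omega>. blinfun_apply (\<psi> k \<omega>) (sample l [0] [1] \<omega>))" for k l
  have Theta: "[0] \<in> Theta" "[1] \<in> Theta"
    by (simp_all add: Theta_def)
  have m: "1 \<le> real m"
    using m_pos by simp
  have indep_k: "indep_set (generated_events P Theta Zs Z) {\<psi> k -` A \<inter> space P | A. A \<in> sets strong_algebra}" for k
  proof -
    have "{\<psi> k -` A \<inter> space P | A. A \<in> sets strong_algebra} \<subseteq> generated_events P UNIV strong_algebra \<psi>"
      unfolding generated_events_def by (auto intro: sigma_sets.Basic)
    then show ?thesis
      using indep unfolding indep_sets2_eq by blast
  qed
  have e_1: "second_moment P (\<lambda>\<omega>. blinfun_apply (\<psi> k \<omega>) (Y [1] (int n) \<omega> - y)) = e k n" for k n :: nat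
    using second_moment_Y_index[OF \<psi> indep_k Theta(2), of k "Suc n" y] by (simp add: e_def)
  have difference: "s k l \<le> ennreal (2 * c) * (e (k + 1) l + e (k + 1) (l - 1))" if "1 \<le> l" for k l
  proof -
    have l: "int l - 1 = int (l - 1)"
      using that by simp
    have meas: "(\<lambda>\<omega>. blinfun_apply (\<psi> k \<omega>) (Y \<theta> (int n) \<omega> - y)) \<in> borel_measurable P"
      if "\<theta> \<in> Theta" for \<theta> and k n :: nat
      using measurable_Y[OF that, of "Suc n"] by (intro borel_measurable_blinfun_apply_strong \<psi>) simp
    have "second_moment P (\<lambda>\<omega>. blinfun_apply (\<psi> (k + 1) \<omega>) (Y [0] (int l) \<omega> - Y [1] (int l - 1) \<omega>))
      \<le> (\<integral>\<^sup>+ \<omega>. 2 * ennreal ((norm (blinfun_apply (\<psi> (k + 1) \<omega>) (Y [0] (int l) \<omega> - y)))\<^sup>2)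
          + 2 * ennreal ((norm (blinfun_apply (\<psi> (k + 1) \<omega>) (Y [1] (int (l - 1)) \<omega> - y)))\<^sup>2) \<partial>P)"
    proof (rule nn_integral_mono)
      fix \<omega>
      show "ennreal ((norm (blinfun_apply (\<psi> (k + 1) \<omega>) (Y [0] (int l) \<omega> - Y [1] (int l - 1) \<omega>)))\<^sup>2)
        \<le> 2 * ennreal ((norm (blinfun_apply (\<psi> (k + 1) \<omega>) (Y [0] (int l) \<omega> - y)))\<^sup>2)
          + 2 * ennreal ((norm (blinfun_apply (\<psi> (k + 1) \<omega>) (Y [1] (int (l - 1)) \<omega> - y)))\<^sup>2)"
        using ennreal_leI[OF norm_blinfun_diff_square_le[of "\<psi> (k + 1) \<omega>" "Y [0] (int l) \<omega>" "Y [1] (int l - 1) \<omega>" y]]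
        unfolding l by (simp add: ennreal_mult)
    qed
    also have "\<dots> = 2 * second_moment P (\<lambda>\<omega>. blinfun_apply (\<psi> (k + 1) \<omega>) (Y [0] (int l) \<omega> - y))
        + 2 * second_moment P (\<lambda>\<omega>. blinfun_apply (\<psi> (k + 1) \<omega>) (Y [1] (int (l - 1)) \<omega> - y))"
      using meas[OF Theta(1), of "k + 1" l] meas[OF Theta(2), of "k + 1" "l - 1"]
      by (simp add: nn_integral_add nn_integral_cmult)
    also have "\<dots> = 2 * e (k + 1) l + 2 * e (k + 1) (l - 1)"
      by (simp only: e_1) (simp only: e_def)
    finally have "s k l \<le> ennreal c * (2 * e (k + 1) l + 2 * e (k + 1) (l - 1))"
      unfolding s_def by (intro order_trans[OF contract[OF that]] mult_left_mono) auto
    also have "\<dots> = ennreal (2 * c) * (e (k + 1) l + e (k + 1) (l - 1))"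
      using c by (simp add: ennreal_mult distrib_left mult_ac)
    finally show ?thesis .
  qed
  have "e 0 N \<le> ennreal (K / real m ^ (0 + N) * (1 + 4 * c) ^ N)"
  proof (rule error_recursion_bound[OF m c K, where e = e and N = N])
    fix k assume "1 \<le> k" "k \<le> N"
    moreover have "e k 0 = second_moment P (\<lambda>\<omega>. blinfun_apply (\<psi> k \<omega>) (y0 - y))"
      unfolding e_def by (intro nn_integral_cong) (simp add: Y_zero[OF Theta(1)])
    ultimately show "e k 0 \<le> ennreal (K / real m ^ k)"
      using Y_0 by simp
  next
    fix k n assume n: "1 \<le> n" and kn: "k + n \<le> N"
    have n1: "int n - 1 = int (n - 1)"
      using n by simp
    have "e k n \<le> second_moment P (\<lambda>\<omega>. blinfun_apply (\<psi> k \<omega>) (y - (\<Sum>l = 0..<n. expectation (sample l [0] [1]))))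
       + (\<Sum>l = 0..<n. ennreal (1 / real m ^ (n - l)) * s k l)"
      unfolding e_def s_def by (rule second_moment_Y_error[OF \<psi> indep_k integrable n])
    also have "\<dots> \<le> ennreal (2 * c) * e (k + 1) (n - 1) + (\<Sum>l = 0..<n. ennreal (1 / real m ^ (n - l)) * s k l)"
      using bias[OF n, of k] unfolding n1 e_def by (rule add_right_mono)
    \<comment> \<open>Level 0 is split off because the contraction hypothesis starts at level 1; its
      sample has a direct bound, and it supplies the inhomogeneous term of the recursion.\<close>
    also have "(\<Sum>l = 0..<n. ennreal (1 / real m ^ (n - l)) * s k l)
        = ennreal (1 / real m ^ n) * s k 0 + (\<Sum>l = 1..<n. ennreal (1 / real m ^ (n - l)) * s k l)"
      using n by (simp add: sum.atLeast_Suc_lessThan)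
    also have "\<dots> \<le> ennreal (K / real m ^ (k + n))
        + (\<Sum>l = 1..<n. ennreal (1 / real m ^ (n - l)) * (ennreal (2 * c) * (e (k + 1) l + e (k + 1) (l - 1))))"
    proof (intro add_mono sum_mono mult_left_mono difference)
      have "ennreal (1 / real m ^ n) * s k 0 \<le> ennreal (1 / real m ^ n) * ennreal (K / real m ^ k)"
        using sample_0[of k] kn unfolding s_def by (intro mult_left_mono) auto
      also have "\<dots> = ennreal (K / real m ^ (k + n))"
        using K by (simp add: ennreal_mult[symmetric] power_add mult_ac)
      finally show "ennreal (1 / real m ^ n) * s k 0 \<le> ennreal (K / real m ^ (k + n))" .
    qed auto
    finally show "e k n \<le> ennreal (K / real m ^ (k + n)) + ennreal (2 * c) * e (k + 1) (n - 1)
        + (\<Sum>l = 1..<n. ennreal (1 / real m ^ (n - l)) * (ennreal (2 * c) * (e (k + 1) l + e (k + 1) (l - 1))))"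
      by (simp add: add_ac add_left_mono)
  qed (use N in auto)
  then show ?thesis
    by (simp add: e_def)
qed

subsection \<open>Error and complexity\<close>

theorem theorem2p14:
  fixes P :: "'w measure"
    and Zs :: "'z measure"
    and \<zz> \<gamma> \<BB> \<bb> C c :: real
    and \<cc> :: "nat \<Rightarrow> real"
    and M :: "nat \<Rightarrow> nat"
    and y \<yy>\<^sub>m \<yy>\<^sub>0 :: "'y :: {banach, second_countable_topology}"
    and Z :: "int list \<Rightarrow> 'w \<Rightarrow> 'z"
    and \<psi> :: "nat \<Rightarrow> 'w \<Rightarrow> ('y \<Rightarrow>\<^sub>L 'h :: {real_inner, banach, second_countable_topology})"
    and \<Phi> :: "nat \<Rightarrow> 'y \<times> 'y \<times> 'z \<Rightarrow> 'y"
    and Y :: "int list \<Rightarrow> int \<Rightarrow> nat \<Rightarrow> 'w \<Rightarrow> 'y"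
    and Cost :: "int \<Rightarrow> nat \<Rightarrow> real"
  assumes "prob_space P"
    and "0 \<le> \<zz>" and "0 \<le> \<gamma>" and "1 \<le> \<BB>" and "1 \<le> \<bb>" and "1 \<le> C" and "0 < c"
    and "\<And>k. 0 < \<cc> k"
    and "\<And>j. 1 \<le> j \<Longrightarrow> 1 \<le> M j"
    and "liminf (\<lambda>j. ereal (real (M j))) = \<infinity>"
    and "(SUP j\<in>{1..}. ereal (real (M (j + 1)) / real (M j))) \<le> ereal \<BB>"
    and "\<And>n. 1 \<le> n \<Longrightarrow> (MAX k\<in>{0..n}. real (M n) ^ k / \<cc> k) \<le> \<bb> ^ n"
    and "\<And>\<theta>. \<theta> \<in> Theta \<Longrightarrow> Z \<theta> \<in> measurable P Zs"
    and "prob_space.indep_vars P (\<lambda>_. Zs) Z Theta"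
    and "\<And>\<theta> \<eta>. \<theta> \<in> Theta \<Longrightarrow> \<eta> \<in> Theta \<Longrightarrow> distr P Zs (Z \<theta>) = distr P Zs (Z \<eta>)"
    and "\<And>k. \<psi> k \<in> measurable P strong_algebra"
    and "prob_space.indep_set P (generated_events P Theta Zs Z)
           (generated_events P UNIV strong_algebra \<psi>)"
    and "\<And>l. \<Phi> l \<in> measurable (borel \<Otimes>\<^sub>M borel \<Otimes>\<^sub>M Zs) borel"
    and "\<And>\<theta> j \<omega>. \<theta> \<in> Theta \<Longrightarrow> 1 \<le> j \<Longrightarrow> \<omega> \<in> space P \<Longrightarrow> Y \<theta> (-1) j \<omega> = \<yy>\<^sub>m"
    and "\<And>\<theta> j \<omega>. \<theta> \<in> Theta \<Longrightarrow> 1 \<le> j \<Longrightarrow> \<omega> \<in> space P \<Longrightarrow> Y \<theta> 0 j \<omega> = \<yy>\<^sub>0"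
    and "\<And>\<theta> n j \<omega>. \<theta> \<in> Theta \<Longrightarrow> 1 \<le> n \<Longrightarrow> 1 \<le> j \<Longrightarrow> \<omega> \<in> space P \<Longrightarrow>
           Y \<theta> (int n) j \<omega> =
             (\<Sum>l = 0..<n. (1 / real (M j) ^ (n - l)) *\<^sub>R
                (\<Sum>i = 1..M j ^ (n - l).
                   \<Phi> l (Y (\<theta> @ [int l, int i]) (int l) j \<omega>,
                        Y (\<theta> @ [- int l, int i]) (int l - 1) j \<omega>,
                        Z (\<theta> @ [int l, int i]) \<omega>)))"
    and "\<And>n j. -1 \<le> n \<Longrightarrow> 1 \<le> j \<Longrightarrow> 0 \<le> Cost n j"
    and "\<And>j. 1 \<le> j \<Longrightarrow> Cost (-1) j = 0"
    and "\<And>j. 1 \<le> j \<Longrightarrow> Cost 0 j = 0"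
    and "\<And>n j. 1 \<le> n \<Longrightarrow> 1 \<le> j \<Longrightarrow>
           Cost (int n) j \<le> real (M j) ^ n * \<zz> +
             (\<Sum>l = 0..<n. real (M j) ^ (n - l) *
                (Cost (int l) j + Cost (int l - 1) j + \<gamma> * \<zz>))"
    and "\<And>k j. 1 \<le> j \<Longrightarrow>
           (\<integral>\<^sup>+ \<omega>. ennreal (norm (\<Phi> k (Y [0] (int k) j \<omega>, Y [1] (int k - 1) j \<omega>, Z [0] \<omega>))) \<partial>P) < \<infinity>"
    and "\<And>k. max
           (second_moment P (\<lambda>\<omega>. blinfun_apply (\<psi> k \<omega>) (\<Phi> 0 (\<yy>\<^sub>0, \<yy>\<^sub>m, Z [0] \<omega>))))
           (indicator {1..} k * second_moment P (\<lambda>\<omega>. blinfun_apply (\<psi> k \<omega>) (\<yy>\<^sub>0 - y)))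
           \<le> ennreal (C\<^sup>2 / \<cc> k)"
    and "\<And>k n j. 1 \<le> n \<Longrightarrow> 1 \<le> j \<Longrightarrow>
           second_moment P (\<lambda>\<omega>. blinfun_apply (\<psi> k \<omega>)
             (\<Phi> n (Y [0] (int n) j \<omega>, Y [1] (int n - 1) j \<omega>, Z [0] \<omega>)))
           \<le> ennreal c * second_moment P (\<lambda>\<omega>. blinfun_apply (\<psi> (k + 1) \<omega>)
               (Y [0] (int n) j \<omega> - Y [1] (int n - 1) j \<omega>))"
    and "\<And>k n j. 1 \<le> n \<Longrightarrow> 1 \<le> j \<Longrightarrow>
           second_moment P (\<lambda>\<omega>. blinfun_apply (\<psi> k \<omega>)
             (y - (\<Sum>l = 0..<n.
                \<integral>\<omega>'. \<Phi> l (Y [0] (int l) j \<omega>', Y [1] (int l - 1) j \<omega>', Z [0] \<omega>') \<partial>P)))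
           \<le> ennreal (2 * c) * second_moment P (\<lambda>\<omega>. blinfun_apply (\<psi> (k + 1) \<omega>)
               (Y [0] (int n - 1) j \<omega> - y))"
  shows "(\<forall>n\<ge>1.
            ennsqrt (second_moment P (\<lambda>\<omega>. blinfun_apply (\<psi> 0 \<omega>) (Y [0] (int n) n \<omega> - y)))
              \<le> ennreal (C * (\<bb> * (1 + 4 * c) / real (M n)) powr (real n / 2)) \<and>
            ennreal (C * (\<bb> * (1 + 4 * c) / real (M n)) powr (real n / 2)) < \<infinity>) \<and>
         (\<forall>n\<ge>1. Cost (int n) n \<le> (3 + \<gamma>) ^ n * real (M n) ^ n * \<zz>) \<and>
         (\<exists>N :: real \<Rightarrow> nat.
            (\<forall>\<epsilon>\<in>{0<..1}. 1 \<le> N \<epsilon>) \<and>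
            (\<forall>\<epsilon>\<in>{0<..1}. \<forall>\<delta>>0.
               (SUP n\<in>{N \<epsilon>..}.
                  ennsqrt (second_moment P (\<lambda>\<omega>. blinfun_apply (\<psi> 0 \<omega>) (Y [0] (int n) n \<omega> - y))))
                 \<le> ennreal \<epsilon> \<and>
               (let bound = ennreal (\<zz> * \<bb> * \<cc> 1 * (3 + \<gamma>) * C powr (2 * (1 + \<delta>))) *
                      (1 + (SUP n\<in>{1..}.
                         ennreal (((\<BB> * \<bb>\<^sup>2 * (3 + \<gamma>) * (1 + 4 * c)) powr (1 + \<delta>)
                                    / real (M n) powr \<delta>) ^ n))) *
                      ennreal (\<epsilon> powr (- 2 * (1 + \<delta>)))
                in ennreal (Cost (int (N \<epsilon>)) (N \<epsilon>)) \<le> bound \<and> bound < \<infinity>)))"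
proof -
  interpret prob_space P by fact
  define q where "q = 3 + \<gamma>"
  define a where "a = \<bb> * (1 + 4 * c)"
  define err where "err n = C * (a / real (M n)) powr (real n / 2)" for n
  note [simp] = assms(8) less_imp_le[OF assms(8)]
  have "1 * 1 \<le> \<bb> * (1 + 4 * c)"
    using assms(5,7) by (intro mult_mono) auto
  then have a: "1 \<le> a"
    by (simp add: a_def)
  have q: "1 \<le> q"
    using assms(3) by (simp add: q_def)
  have M_pos: "1 \<le> real (M n)" if "1 \<le> n" for n
    using assms(9)[OF that] by simp
  have M_power: "real (M n) ^ k \<le> \<bb> ^ n * \<cc> k" if "1 \<le> n" "k \<le> n" for n k
  proof -
    have "real (M n) ^ k / \<cc> k \<le> (MAX k\<in>{0..n}. real (M n) ^ k / \<cc> k)"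
      using that by (intro Max_ge) auto
    also have "\<dots> \<le> \<bb> ^ n"
      using assms(12)[OF that(1)] .
    finally show ?thesis
      by (simp add: divide_le_eq)
  qed
  have M_ratio: "real (M (n + 1)) \<le> \<BB> * real (M n)" if "1 \<le> n" for n
  proof -
    have "ereal (real (M (n + 1)) / real (M n)) \<le> ereal \<BB>"
      using assms(11) that by (auto simp: SUP_le_iff)
    then show ?thesis
      using M_pos[OF that] by (simp add: divide_le_eq)
  qed
  have M_lim: "filterlim M at_top sequentially"
  proof -
    have "(\<lambda>j. ereal (real (M j))) \<longlonglongrightarrow> \<infinity>"
      using assms(10) by (simp add: Liminf_PInfty)
    then have "filterlim (\<lambda>j. real (M j)) at_top sequentially"
      by (simp add: tendsto_PInfty_eq_at_top)
    then show ?thesis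
      by (simp add: filterlim_sequentially_iff_filterlim_real)
  qed

  have error: "ennsqrt (second_moment P (\<lambda>\<omega>. blinfun_apply (\<psi> 0 \<omega>) (Y [0] (int n) n \<omega> - y))) \<le> ennreal (err n)"
    if n: "1 \<le> n" for n
  proof -
    \<comment> \<open>The diagonal: the sample count is \<open>M n\<close>, with \<open>n\<close>
      also the level at which the error is evaluated.\<close>
    interpret multilevel_picard P Zs Z \<Phi> \<yy>\<^sub>m \<yy>\<^sub>0 "M n" "\<lambda>\<theta> k. Y \<theta> k n"
      by unfold_locales (rule assms(9,13-15,18-21); (assumption | rule n))+
    have sample_eq: "sample l [0] [1] = (\<lambda>\<omega>. \<Phi> l (Y [0] (int l) n \<omega>, Y [1] (int l - 1) n \<omega>, Z [0] \<omega>))" for l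
      by (simp add: fun_eq_iff sample_def)
    have Theta: "[0] \<in> Theta" "[1] \<in> Theta"
      by (simp_all add: Theta_def)
    \<comment> \<open>This fixes the constant of the recursion as \<open>C^2 * \<bb> ^ n\<close>.
      The restriction \<open>k \<le> n\<close> comes from the finite maximum in the condition on
      \<open>M n\<close>.\<close>
    have scale: "C\<^sup>2 / \<cc> k \<le> C\<^sup>2 * \<bb> ^ n / real (M n) ^ k" if "k \<le> n" for k
    proof -
      have "C\<^sup>2 * real (M n) ^ k \<le> C\<^sup>2 * (\<bb> ^ n * \<cc> k)"
        using M_power[OF n that] by (intro mult_left_mono) auto
      then show ?thesis
        using M_pos[OF n] by (simp add: field_simps)
    qed
    have "second_moment P (\<lambda>\<omega>. blinfun_apply (\<psi> 0 \<omega>) (Y [0] (int n) n \<omega> - y))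
        \<le> ennreal (C\<^sup>2 * \<bb> ^ n / real (M n) ^ n * (1 + 4 * c) ^ n)"
    proof (rule second_moment_Y_error_bound[OF assms(16,17)])
      show "integrable P (sample l [0] [1])" for l
        using assms(26)[OF n, of l] measurable_sample[OF Theta, of l]
        by (simp add: integrable_iff_bounded sample_eq)
      show "0 \<le> c" "0 \<le> C\<^sup>2 * \<bb> ^ n"
        using assms(5,7) by auto
      show "second_moment P (\<lambda>\<omega>. blinfun_apply (\<psi> k \<omega>) (sample 0 [0] [1] \<omega>)) \<le> ennreal (C\<^sup>2 * \<bb> ^ n / real (M n) ^ k)"
        if "k \<le> n" for k
      proof -
        have "second_moment P (\<lambda>\<omega>. blinfun_apply (\<psi> k \<omega>) (sample 0 [0] [1] \<omega>))
            = second_moment P (\<lambda>\<omega>. blinfun_apply (\<psi> k \<omega>) (\<Phi> 0 (\<yy>\<^sub>0, \<yy>\<^sub>m, Z [0] \<omega>)))"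
          by (intro nn_integral_cong) (simp add: sample_zero Theta)
        also have "\<dots> \<le> ennreal (C\<^sup>2 / \<cc> k)"
          using assms(27)[of k] by simp
        also have "\<dots> \<le> ennreal (C\<^sup>2 * \<bb> ^ n / real (M n) ^ k)"
          by (intro ennreal_leI scale that)
        finally show ?thesis .
      qed
      show "second_moment P (\<lambda>\<omega>. blinfun_apply (\<psi> k \<omega>) (\<yy>\<^sub>0 - y)) \<le> ennreal (C\<^sup>2 * \<bb> ^ n / real (M n) ^ k)"
        if "1 \<le> k" "k \<le> n" for k
      proof -
        have "second_moment P (\<lambda>\<omega>. blinfun_apply (\<psi> k \<omega>) (\<yy>\<^sub>0 - y)) \<le> ennreal (C\<^sup>2 / \<cc> k)"
          using assms(27)[of k] that(1) by simp
        also have "\<dots> \<le> ennreal (C\<^sup>2 * \<bb> ^ n / real (M n) ^ k)"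
          by (intro ennreal_leI scale that)
        finally show ?thesis .
      qed
      show "second_moment P (\<lambda>\<omega>. blinfun_apply (\<psi> k \<omega>) (sample l [0] [1] \<omega>)) \<le> ennreal c *
          second_moment P (\<lambda>\<omega>. blinfun_apply (\<psi> (k + 1) \<omega>) (Y [0] (int l) n \<omega> - Y [1] (int l - 1) n \<omega>))"
        if "1 \<le> l" for k l
        unfolding sample_eq by (rule assms(28)[OF that n])
      show "second_moment P (\<lambda>\<omega>. blinfun_apply (\<psi> k \<omega>) (y - (\<Sum>l = 0..<i. expectation (sample l [0] [1]))))
          \<le> ennreal (2 * c) * second_moment P (\<lambda>\<omega>. blinfun_apply (\<psi> (k + 1) \<omega>) (Y [0] (int i - 1) n \<omega> - y))"
        if "1 \<le> i" for k i
        unfolding sample_eq by (rule assms(29)[OF that n])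
    qed (rule n)
    also have "C\<^sup>2 * \<bb> ^ n / real (M n) ^ n * (1 + 4 * c) ^ n = (err n)\<^sup>2"
    proof -
      have "((a / real (M n)) powr (real n / 2))\<^sup>2 = (a / real (M n)) powr (real n)"
        by (simp add: power2_eq_square powr_add[symmetric])
      also have "\<dots> = (a / real (M n)) ^ n"
        using a M_pos[OF n] by (intro powr_realpow) simp
      finally show ?thesis
        by (simp add: err_def power_mult_distrib power_divide a_def)
    qed
    finally show ?thesis
      using assms(6) by (intro ennsqrt_le) (simp_all add: err_def)
  qed

  have cost: "Cost (int n) n \<le> q ^ n * real (M n) ^ n * \<zz>" if n: "1 \<le> n" for n
    unfolding q_def
    using cost_recursion_bound[of "real (M n)" \<zz> \<gamma> "\<lambda>i. Cost i n" n] M_pos[OF n] assms(2,3) assms(23-25)[OF n]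
      assms(25)[OF _ n] by simp

  \<comment> \<open>The bound \<open>err\<close> need not be monotone, so all later indices are
    included, as the supremum in the claim demands. Neither \<open>good\<close> nor \<open>N\<close>
    involves \<open>\<delta>\<close>, hence one threshold serves every
    \<open>\<delta>\<close>.\<close>
  define good where "good \<epsilon> N \<longleftrightarrow> 1 \<le> N \<and> (\<forall>n\<ge>N. err n \<le> \<epsilon>)" for \<epsilon> N
  define N where "N \<epsilon> = (LEAST N. good \<epsilon> N)" for \<epsilon>
  have good_N: "good \<epsilon> (N \<epsilon>)" if \<epsilon>: "0 < \<epsilon>" for \<epsilon>
  proof -
    obtain K where "\<And>n. n \<ge> K \<Longrightarrow> err n \<le> \<epsilon>"
      using eventually_powr_error_le[OF M_lim _ _ \<epsilon>, of a C] a assms(6)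
      by (auto simp: err_def eventually_sequentially)
    then have "good \<epsilon> (max 1 K)"
      by (simp add: good_def)
    then show ?thesis
      unfolding N_def by (rule LeastI)
  qed
  \<comment> \<open>All indices from \<open>Suc n\<close> on are already below
    \<open>\<epsilon>\<close>; if \<open>n\<close> were too, it would be a smaller good
    index.\<close>
  have N_minimal: "\<epsilon> < err n" if n: "0 < \<epsilon>" "N \<epsilon> = Suc n" "1 \<le> n" for \<epsilon> n
  proof (rule ccontr)
    assume "\<not> \<epsilon> < err n"
    then have "err k \<le> \<epsilon>" if "n \<le> k" for k
      using good_N[OF n(1)] n(2) that by (cases "k = n") (auto simp: good_def)
    then have "good \<epsilon> n"
      using n(3) by (simp add: good_def)
    then have "N \<epsilon> \<le> n"
      unfolding N_def by (rule Least_le)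
    then show False
      using n(2) by simp
  qed

  define t where "t \<delta> n = ((\<BB> * \<bb>\<^sup>2 * (3 + \<gamma>) * (1 + 4 * c)) powr (1 + \<delta>) / real (M n) powr \<delta>) ^ n" for \<delta> n
  define A where "A \<delta> = \<zz> * \<bb> * \<cc> 1 * (3 + \<gamma>) * C powr (2 * (1 + \<delta>))" for \<delta>
  have t_nonneg: "0 \<le> t \<delta> n" for \<delta> n
    by (simp add: t_def)
  have A_nonneg: "0 \<le> A \<delta>" for \<delta>
    using assms(2,3,5) by (simp add: A_def)
  have SUP_finite: "(SUP n\<in>{1..}. ennreal (t \<delta> n)) < \<infinity>" if \<delta>: "0 < \<delta>" for \<delta>
  proof -
    obtain B where "\<And>n. t \<delta> n \<le> B"
      unfolding t_def
      using powr_threshold_sequence_bounded[OF M_lim \<delta>, of "(\<BB> * \<bb>\<^sup>2 * (3 + \<gamma>) * (1 + 4 * c)) powr (1 + \<delta>)"]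
      by auto
    then have "(SUP n\<in>{1..}. ennreal (t \<delta> n)) \<le> ennreal B"
      by (intro SUP_least ennreal_leI)
    then show ?thesis
      by (simp add: le_less_trans)
  qed
  \<comment> \<open>The two cases lead to different factors: \<open>T = 1\<close> if the threshold
    is 1 and has no predecessor, \<open>T = t \<delta> n\<close> if it is \<open>Suc n\<close>. The
    sum of 1 and the supremum dominates both.\<close>
  have cost_N: "\<exists>T\<ge>0. ennreal T \<le> 1 + (SUP n\<in>{1..}. ennreal (t \<delta> n)) \<and>
      Cost (int (N \<epsilon>)) (N \<epsilon>) \<le> A \<delta> * T * \<epsilon> powr (- 2 * (1 + \<delta>))"
    if \<epsilon>: "0 < \<epsilon>" "\<epsilon> \<le> 1" and \<delta>: "0 < \<delta>" for \<epsilon> \<delta>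
  proof (cases "N \<epsilon> = 1")
    case True
    \<comment> \<open>With no error inequality at a preceding index, the cost is bounded by
      \<open>M 1 \<le> \<bb> * \<cc> 1\<close>, and the remaining factors of the claim are at least
      1 since \<open>1 \<le> C\<close> and \<open>\<epsilon> \<le> 1\<close>.\<close>
    have "1 * 1 \<le> C powr (2 * (1 + \<delta>)) * \<epsilon> powr (- 2 * (1 + \<delta>))"
    proof (intro mult_mono)
      show "1 \<le> C powr (2 * (1 + \<delta>))"
        using assms(6) \<delta> by (intro ge_one_powr_ge_zero) auto
      have "\<epsilon> powr 0 \<le> \<epsilon> powr (- 2 * (1 + \<delta>))"
        using \<epsilon> \<delta> by (intro powr_mono') auto
      then show "1 \<le> \<epsilon> powr (- 2 * (1 + \<delta>))"
        using \<epsilon> by simp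
    qed auto
    then have one: "1 \<le> C powr (2 * (1 + \<delta>)) * \<epsilon> powr (- 2 * (1 + \<delta>))"
      by simp
    have "Cost (int 1) 1 \<le> q * (\<bb> * \<cc> 1) * \<zz>"
      using order_trans[OF cost[of 1] mult_right_mono[OF mult_left_mono[OF M_power[of 1 1]]]] q assms(2) by simp
    also have "\<dots> \<le> q * (\<bb> * \<cc> 1) * \<zz> * (C powr (2 * (1 + \<delta>)) * \<epsilon> powr (- 2 * (1 + \<delta>)))"
      using mult_left_mono[OF one, of "q * (\<bb> * \<cc> 1) * \<zz>"] q assms(2,5) by simp
    also have "\<dots> = A \<delta> * 1 * \<epsilon> powr (- 2 * (1 + \<delta>))"
      by (simp add: A_def q_def mult_ac)
    finally show ?thesis
      unfolding True by (intro exI[of _ 1]) simp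
  next
    case False
    then obtain n where n: "N \<epsilon> = Suc n" "1 \<le> n"
      using good_N[OF \<epsilon>(1)] by (cases "N \<epsilon>") (auto simp: good_def)
    have "Cost (int (Suc n)) (Suc n) \<le> q ^ Suc n * real (M (Suc n)) ^ Suc n * \<zz>"
      by (rule cost) simp
    also have "\<dots> \<le> \<zz> * \<bb> * \<cc> 1 * q * C powr (2 * (1 + \<delta>))
        * ((q * \<BB> * \<bb> * a) powr (1 + \<delta>) / real (M n) powr \<delta>) ^ n * \<epsilon> powr (- 2 * (1 + \<delta>))"
    proof (rule cost_at_threshold_le[OF a assms(5,4) q assms(6) \<epsilon>(1) \<delta> assms(2) assms(8) M_pos[OF n(2)]])
      show "\<epsilon> \<le> C * (a / real (M n)) powr (real n / 2)"
        using N_minimal[OF \<epsilon>(1) n] by (simp add: err_def)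
      show "real (M (Suc n)) \<le> \<BB> * real (M n)"
        using M_ratio[OF n(2)] by simp
      show "real (M (Suc n)) \<le> \<cc> 1 * \<bb> ^ Suc n"
        using M_power[of "Suc n" 1] by (simp add: mult_ac)
    qed simp
    also have "q * \<BB> * \<bb> * a = \<BB> * \<bb>\<^sup>2 * (3 + \<gamma>) * (1 + 4 * c)"
      by (simp add: q_def a_def power2_eq_square)
    finally have "Cost (int (N \<epsilon>)) (N \<epsilon>) \<le> A \<delta> * t \<delta> n * \<epsilon> powr (- 2 * (1 + \<delta>))"
      by (simp only: n(1) A_def q_def t_def)
    moreover have "ennreal (t \<delta> n) \<le> 1 + (SUP n\<in>{1..}. ennreal (t \<delta> n))"
      using n(2) by (intro add_increasing SUP_upper) auto
    ultimately show ?thesis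
      using t_nonneg by blast
  qed

  show ?thesis
  proof (intro conjI allI impI exI[of _ N] ballI)
    fix n :: nat assume n: "1 \<le> n"
    show "ennsqrt (second_moment P (\<lambda>\<omega>. blinfun_apply (\<psi> 0 \<omega>) (Y [0] (int n) n \<omega> - y)))
        \<le> ennreal (C * (\<bb> * (1 + 4 * c) / real (M n)) powr (real n / 2))"
      using error[OF n] by (simp only: err_def a_def)
    show "ennreal (C * (\<bb> * (1 + 4 * c) / real (M n)) powr (real n / 2)) < \<infinity>"
      by simp
    show "Cost (int n) n \<le> (3 + \<gamma>) ^ n * real (M n) ^ n * \<zz>"
      using cost[OF n] by (simp only: q_def)
  next
    fix \<epsilon> :: real assume "\<epsilon> \<in> {0<..1}"
    then have \<epsilon>: "0 < \<epsilon>" "\<epsilon> \<le> 1" by auto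
    show "1 \<le> N \<epsilon>"
      using good_N[OF \<epsilon>(1)] by (simp add: good_def)
    fix \<delta> :: real assume \<delta>: "0 < \<delta>"
    show "(SUP n\<in>{N \<epsilon>..}.
        ennsqrt (second_moment P (\<lambda>\<omega>. blinfun_apply (\<psi> 0 \<omega>) (Y [0] (int n) n \<omega> - y)))) \<le> ennreal \<epsilon>"
    proof (rule SUP_least)
      fix n assume "n \<in> {N \<epsilon>..}"
      then have "1 \<le> n" "err n \<le> \<epsilon>"
        using good_N[OF \<epsilon>(1)] by (auto simp: good_def)
      then show "ennsqrt (second_moment P (\<lambda>\<omega>. blinfun_apply (\<psi> 0 \<omega>) (Y [0] (int n) n \<omega> - y))) \<le> ennreal \<epsilon>"
        using error ennreal_leI order_trans by blast
    qed
    let ?S = "SUP n\<in>{1..}. ennreal (t \<delta> n)"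
    obtain T where T: "0 \<le> T" "ennreal T \<le> 1 + ?S"
      "Cost (int (N \<epsilon>)) (N \<epsilon>) \<le> A \<delta> * T * \<epsilon> powr (- 2 * (1 + \<delta>))"
      using cost_N[OF \<epsilon> \<delta>] by blast
    have "ennreal (Cost (int (N \<epsilon>)) (N \<epsilon>)) \<le> ennreal (A \<delta>) * ennreal T * ennreal (\<epsilon> powr (- 2 * (1 + \<delta>)))"
      using ennreal_leI[OF T(3)] T(1) A_nonneg[of \<delta>] by (simp add: ennreal_mult)
    also have "\<dots> \<le> ennreal (A \<delta>) * (1 + ?S) * ennreal (\<epsilon> powr (- 2 * (1 + \<delta>)))"
      by (intro mult_right_mono mult_left_mono T(2)) auto
    finally have "ennreal (Cost (int (N \<epsilon>)) (N \<epsilon>)) \<le> ennreal (A \<delta>) * (1 + ?S) * ennreal (\<epsilon> powr (- 2 * (1 + \<delta>)))" .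
    moreover have "ennreal (A \<delta>) * (1 + ?S) * ennreal (\<epsilon> powr (- 2 * (1 + \<delta>))) < \<infinity>"
      using SUP_finite[OF \<delta>] by (simp add: ennreal_mult_less_top)
    ultimately show "let bound = ennreal (\<zz> * \<bb> * \<cc> 1 * (3 + \<gamma>) * C powr (2 * (1 + \<delta>))) *
          (1 + (SUP n\<in>{1..}. ennreal (((\<BB> * \<bb>\<^sup>2 * (3 + \<gamma>) * (1 + 4 * c)) powr (1 + \<delta>)
                / real (M n) powr \<delta>) ^ n))) * ennreal (\<epsilon> powr (- 2 * (1 + \<delta>)))
        in ennreal (Cost (int (N \<epsilon>)) (N \<epsilon>)) \<le> bound \<and> bound < \<infinity>"
      unfolding Let_def t_def A_def by blast
  qed
qed

end
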